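(* Let $\Omega\subset\mathbb{R}^d$ be open and bounded, let $y\in C(\Omega;\mathbb{R}^d)$ be strictly orientation preserving, and let $\mathcal{O}=\{A\subset\subset\Omega: A\text{ is open}\}$. Assume in addition that $y\in\operatorname{DEG1}_{\mathrm{loc}}$ with respect to a regular inner covering $(\Omega_m)_{m\in\mathbb{N}}$ of $\Omega$, and that $y(\partial\Omega_m)$ has empty interior for all $m$. Then the following hold. (i) For all $A\in\mathcal{O}$, $\operatorname{deg}(y;A;\cdot)=1$ on $y(A)\setminus y(\partial A)$. (ii) For all $z\in y(\mathcal{R}_y(\Omega))$, the set $\mathcal{R}_y(\Omega)\cap y^{-1}(\{z\})$ is connected and compactly contained in $\mathcal{R}_y(\Omega)$. (iii) For all $z\in y(\Omega)\setminus y(\mathcal{R}_y(\Omega))$ and every connected component $C_z$ of $y^{-1}(\{z\})$, $\bar C_z\cap\partial\Omega\neq\emptyset$. (iv) $\operatorname{im}_{\mathrm{loc}}(y;\Omega)=y(\mathcal{R}_y(\Omega))$, and $\Omega\setminus\mathcal{R}_y(\Omega)$ has empty interior. If in addition $y\in C(\bar\Omega;\mathbb{R}^d)$, then $\operatorname{im}_{\mathrm{loc}}(y;\Omega)=y(\Omega)\setminus y(\partial\Omega)$ and $\operatorname{deg}(y;\Omega;\cdot)=1$ on $\operatorname{im}_{\mathrm{loc}}(y;\Omega)$.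
   Context: Throughout $d\in\mathbb{N}$, $d\ge2$. $A_1\subset\subset A_2$ means that $\bar A_1$ is compact and $\bar A_1\subset A_2$. $\operatorname{deg}(y;A;z)\in\mathbb{Z}$ is the Brouwer degree of a continuous $y:\bar A\to\mathbb{R}^d$ on a bounded open set $A$ with respect to $z\in\mathbb{R}^d\setminus y(\partial A)$. $\mathcal{L}^d$ is Lebesgue measure. With $\mathcal{O}=\{A\subset\subset\Omega: A\text{ open}\}$ and $y\in C(\Omega;\mathbb{R}^d)$: $y$ is non-degenerate if for each non-empty $V\in\mathcal{O}$ there exist $A\in\mathcal{O}$ with $A\subset V$ and $z\in\mathbb{R}^d\setminus y(\partial A)$ with $\operatorname{deg}(y;A;z)\ne0$; $y$ is orientation preserving if $\operatorname{deg}(y;A;z)\ge0$ for all $A\in\mathcal{O}$ and all $z\in\mathbb{R}^d\setminus y(\partial A)$; strictly orientation preserving means non-degenerate and orientation preserving. For $A\in\mathcal{O}$ and $U\subset\Omega$ open: $\operatorname{im}_T(y;A):=\{z\in\mathbb{R}^d\setminus y(\partial A):\operatorname{deg}(y;A;z)\neq0\}$, $\operatorname{im}_{\mathrm{loc}}(y;U):=\bigcup_{A\in\mathcal{O},\,A\subset U}\operatorname{im}_T(y;A)$, and $\mathcal{R}_y(U):=\{x\in U:\exists A\in\mathcal{O}\text{ with }x\in A\subset U\text{ and }y(x)\notin y(\partial A)\}$. A regular inner covering of an open set $\Omega$ is a family $(\Omega_m)_{m\in\mathbb{N}}$ of open bounded sets with $\Omega_m\subset\Omega_{m+1}\subset\subset\Omega$,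 $\bigcup_m\Omega_m=\Omega$ and $\mathcal{L}^d(\partial\Omega_m)=0$ for every $m$. $y\in\operatorname{DEG1}_{\mathrm{loc}}$ with respect to $(\Omega_m)$ means that $\operatorname{deg}(y;\Omega_m;z)\le1$ for each $m\in\mathbb{N}$ and all $z\in\mathbb{R}^d\setminus y(\partial\Omega_m)$. *)

theory Defs
  imports "HOL-Analysis.Analysis"
begin

definition compactly_contained :: "'a::topological_space set \<Rightarrow> 'a set \<Rightarrow> bool"
    (infix "\<subset>\<subset>" 50) where
  "A \<subset>\<subset> B \<longleftrightarrow> compact (closure A) \<and> closure A \<subseteq> B"

definition inner_open :: "'a::topological_space set \<Rightarrow> 'a set set" where
  "inner_open \<Omega> = {A. open A \<and> A \<subset>\<subset> \<Omega>}"


subsection \<open>Brouwer degree\<close>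

primrec C_order :: "nat \<Rightarrow> ('a::euclidean_space \<Rightarrow> 'b::real_normed_vector) \<Rightarrow> bool" where
  "C_order 0 f \<longleftrightarrow> continuous_on UNIV f"
| "C_order (Suc k) f \<longleftrightarrow>
     (\<exists>f'. (\<forall>x. (f has_derivative f' x) (at x)) \<and> (\<forall>h. C_order k (\<lambda>x. f' x h)))"

definition smooth :: "('a::euclidean_space \<Rightarrow> 'b::real_normed_vector) \<Rightarrow> bool" where
  "smooth f \<longleftrightarrow> (\<forall>k. C_order k f)"

definition jacobian :: "(real^'n \<Rightarrow> real^'n) \<Rightarrow> real^'n \<Rightarrow> real" where
  "jacobian g x = det (matrix (frechet_derivative g (at x)))"

definition regular_value_on :: "(real^'n \<Rightarrow> real^'n) \<Rightarrow> (real^'n) set \<Rightarrow> real^'n \<Rightarrow> bool" where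
  "regular_value_on g A z \<longleftrightarrow> (\<forall>x\<in>A. g x = z \<longrightarrow> jacobian g x \<noteq> 0)"

text \<open>The classical analytic definition: for bounded open \<open>A\<close>, \<open>y\<close> continuous on \<open>closure A\<close> and
  \<open>z \<notin> y ` frontier A\<close>, the degree is the common value of the signed number of preimages of \<open>z\<close>
  in \<open>A\<close> under all smooth maps \<open>g\<close> that have \<open>z\<close> as a regular value and whose uniform distance
  to \<open>y\<close> on \<open>closure A\<close> is less than the distance from \<open>z\<close> to \<open>y ` frontier A\<close>. The last condition
  is stated pointwise, which is equivalent by compactness and also covers \<open>A = {}\<close>, where the degree
  is \<open>0\<close>. The value is unspecified if \<open>A\<close>, \<open>y\<close>, \<open>z\<close> do not meet the requirements above.\<close>

definition degree_approximant ::
    "(real^'n \<Rightarrow> real^'n) \<Rightarrow> (real^'n) set \<Rightarrow> real^'n \<Rightarrow> (real^'n \<Rightarrow> real^'n) \<Rightarrow> bool" where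
  "degree_approximant y A z g \<longleftrightarrow>
     smooth g \<and> regular_value_on g A z \<and>
     (\<forall>x\<in>closure A. \<forall>w\<in>frontier A. dist (g x) (y x) < dist (y w) z)"

definition brouwer_deg :: "(real^'n \<Rightarrow> real^'n) \<Rightarrow> (real^'n) set \<Rightarrow> real^'n \<Rightarrow> int" where
  "brouwer_deg y A z =
     (THE k. \<forall>g. degree_approximant y A z g \<longrightarrow>
        real_of_int k = (\<Sum>x\<in>{x\<in>A. g x = z}. sgn (jacobian g x)))"


subsection \<open>Orientation preserving maps\<close>

definition nondegenerate :: "(real^'n) set \<Rightarrow> (real^'n \<Rightarrow> real^'n) \<Rightarrow> bool" where
  "nondegenerate \<Omega> y \<longleftrightarrow>
     (\<forall>V\<in>inner_open \<Omega>. V \<noteq> {} \<longrightarrow>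
        (\<exists>A\<in>inner_open \<Omega>. A \<subseteq> V \<and> (\<exists>z. z \<notin> y ` frontier A \<and> brouwer_deg y A z \<noteq> 0)))"

definition orientation_preserving :: "(real^'n) set \<Rightarrow> (real^'n \<Rightarrow> real^'n) \<Rightarrow> bool" where
  "orientation_preserving \<Omega> y \<longleftrightarrow>
     (\<forall>A\<in>inner_open \<Omega>. \<forall>z. z \<notin> y ` frontier A \<longrightarrow> brouwer_deg y A z \<ge> 0)"

definition strictly_orientation_preserving ::
    "(real^'n) set \<Rightarrow> (real^'n \<Rightarrow> real^'n) \<Rightarrow> bool" where
  "strictly_orientation_preserving \<Omega> y \<longleftrightarrow> nondegenerate \<Omega> y \<and> orientation_preserving \<Omega> y"

definition im_T :: "(real^'n \<Rightarrow> real^'n) \<Rightarrow> (real^'n) set \<Rightarrow> (real^'n) set" where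
  "im_T y A = {z. z \<notin> y ` frontier A \<and> brouwer_deg y A z \<noteq> 0}"

definition im_loc ::
    "(real^'n) set \<Rightarrow> (real^'n \<Rightarrow> real^'n) \<Rightarrow> (real^'n) set \<Rightarrow> (real^'n) set" where
  "im_loc \<Omega> y U = (\<Union>A\<in>{A\<in>inner_open \<Omega>. A \<subseteq> U}. im_T y A)"

definition reg_set ::
    "(real^'n) set \<Rightarrow> (real^'n \<Rightarrow> real^'n) \<Rightarrow> (real^'n) set \<Rightarrow> (real^'n) set" where
  "reg_set \<Omega> y U = {x\<in>U. \<exists>A\<in>inner_open \<Omega>. x \<in> A \<and> A \<subseteq> U \<and> y x \<notin> y ` frontier A}"

definition regular_inner_covering :: "(real^'n) set \<Rightarrow> (nat \<Rightarrow> (real^'n) set) \<Rightarrow> bool" where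
  "regular_inner_covering \<Omega> W \<longleftrightarrow>
     (\<forall>m. open (W m) \<and> bounded (W m) \<and> W m \<subseteq> W (Suc m) \<and> W (Suc m) \<subset>\<subset> \<Omega> \<and>
          frontier (W m) \<in> null_sets lebesgue) \<and>
     (\<Union>m. W m) = \<Omega>"

definition DEG1_loc :: "(nat \<Rightarrow> (real^'n) set) \<Rightarrow> (real^'n \<Rightarrow> real^'n) \<Rightarrow> bool" where
  "DEG1_loc W y \<longleftrightarrow> (\<forall>m. \<forall>z. z \<notin> y ` frontier (W m) \<longrightarrow> brouwer_deg y (W m) z \<le> 1)"

end

theory Submission
  imports Defs
begin

text \<open>
  The Brouwer degree is controlled by the integral of \<open>bump r (g x - z) * jacobian g x\<close> over \<open>A\<close>.
  Along an affine homotopy that keeps the value \<open>z\<close> off the boundary its derivative is a sum of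
  Jacobians of maps one component of which has compact support, and each of these integrates to zero
  because the cofactor rows are divergence free. At a regular value a change of variables identifies
  the integral with the signed number of preimages, and Sard's theorem supplies regular values.

  For the theorem, density of the complement of \<open>y ` frontier (W m)\<close> and monotonicity in the domain
  bound all degrees by 1, while nondegeneracy makes the degree positive at every value attained off
  the boundary image. By additivity no value can then be attained on two disjoint pieces, which yields
  connectedness of the fibres and disjointness from the boundary image. A compact fibre component has
  a relatively clopen compact neighbourhood in its fibre, so it lies in the regular set.
\<close>

subsection \<open>Determinants and compactly supported functions\<close>

text \<open>They are replaced by the choice of \<open>r\<close>: the kernel vanishes outside the
  ball of radius \<open>r\<close>, and \<open>r\<close> is below the distance from \<open>z\<close>
  to the values taken on the frontier during the homotopy. The integrand is then zero near the
  frontier, extends by zero to the whole space, and is integrated over a box.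

  The degree is a definite description over all admissible smooth maps. Nothing can be read off from
  it until one such map is known to exist and all of them are known to have the same signed count.
  Since \<open>z\<close> is prescribed, a map is made regular at \<open>z\<close> by adding a small
  constant to it.

  In the theorem itself the difficulty is that nondegeneracy supplies only some value of nonzero
  degree in a given open set, and the degree bound is silent on a boundary image. The arguments
  therefore pass from the given value to a nearby one and return by local constancy of the
  degree.\<close>

definition row_upd :: "real^'n^'n \<Rightarrow> 'n \<Rightarrow> real^'n \<Rightarrow> real^'n^'n" where
  "row_upd M i v = (\<chi> k. if k = i then v else M $ k)"

lemma row_upd_nth: "row_upd M i v $ k = (if k = i then v else M $ k)"
  by (simp add: row_upd_def)

text \<open>As a function of \<open>v\<close>, \<open>det (row_upd M i v)\<close> is the scalar
  product of \<open>v\<close> with row \<open>i\<close> of the cofactor matrix. Its linearity takes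
  the place of explicit cofactors below.\<close>

lemma linear_det_row_upd: "linear (\<lambda>v. det (row_upd M i v))"
proof (rule linearI)
  show "det (row_upd M i (v + w)) = det (row_upd M i v) + det (row_upd M i w)" for v w
    unfolding row_upd_def by (rule det_row_add)
  show "det (row_upd M i (c *\<^sub>R v)) = c *\<^sub>R det (row_upd M i v)" for c v
    unfolding row_upd_def using det_row_mul[of i c "\<lambda>_. v" "\<lambda>k. M $ k"]
    by (simp add: scalar_mult_eq_scaleR cong: if_cong)
qed

lemma row_upd_same: "row_upd M i (M $ i) = M"
  by (simp add: row_upd_def vec_eq_iff)

lemma row_upd_commute: "k \<noteq> i \<Longrightarrow> row_upd (row_upd M k w) i v = row_upd (row_upd M i v) k w"
  by (auto simp: row_upd_def vec_eq_iff)

lemma det_row_upd_other: "k \<noteq> i \<Longrightarrow> det (row_upd M i (M $ k)) = 0"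
  by (rule det_identical_rows[of k i]) (auto simp: row_def row_upd_def vec_eq_iff)

lemma det_row_upd_zero: "det (row_upd M i 0) = 0"
  using linear_0[OF linear_det_row_upd] .

text \<open>Polarisation: the determinant vanishes when rows \<open>i\<close> and \<open>k\<close>
  both equal \<open>v + w\<close>, and expanding it bilinearly leaves only the two mixed
  terms.\<close>

lemma det_row_upd_swap:
  assumes "k \<noteq> i"
  shows "det (row_upd (row_upd M k w) i v) = - det (row_upd (row_upd M k v) i w)"
proof -
  define B where "B v w = det (row_upd (row_upd M k w) i v)" for v w
  have l1: "B (v + v') w = B v w + B v' w" for v v' w
    unfolding B_def by (rule linear_add[OF linear_det_row_upd])
  have l2: "B v (w + w') = B v w + B v w'" for v w w'
    unfolding B_def row_upd_commute[OF assms] by (rule linear_add[OF linear_det_row_upd])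
  have z: "B v v = 0" for v
    unfolding B_def by (rule det_identical_rows[of k i]) (use assms in \<open>auto simp: row_def row_upd_def vec_eq_iff\<close>)
  have "B (v + w) (v + w) = B v v + B v w + (B w v + B w w)"
    by (simp only: l1 l2 add_ac)
  then show ?thesis
    using z by (simp add: B_def)
qed

text \<open>Jacobi's formula in row form: the product rule on the Leibniz expansion differentiates
  one factor at a time, and collecting the terms by the row of that factor gives determinants with
  one row replaced.\<close>

lemma has_derivative_det:
  fixes M :: "'a::real_normed_vector \<Rightarrow> real^'n^'n"
  assumes "\<And>i. ((\<lambda>x. M x $ i) has_derivative M' i) (at x within S)"
  shows "((\<lambda>x. det (M x)) has_derivative (\<lambda>h. \<Sum>i\<in>UNIV. det (row_upd (M x) i (M' i h)))) (at x within S)"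
proof -
  have nth: "((\<lambda>x. M x $ i $ j) has_derivative (\<lambda>h. M' i h $ j)) (at x within S)" for i j
    by (rule bounded_linear.has_derivative[OF bounded_linear_vec_nth assms])
  have "((\<lambda>x. det (M x)) has_derivative
      (\<lambda>h. \<Sum>p\<in>{p. p permutes UNIV}. of_int (sign p) *
        (\<Sum>i\<in>UNIV. M' i h $ p i * (\<Prod>j\<in>UNIV - {i}. M x $ j $ p j)))) (at x within S)"
    unfolding det_def
    by (intro has_derivative_sum has_derivative_mult_right has_derivative_prod nth)
  moreover have "(\<Sum>p\<in>{p. p permutes UNIV}. of_int (sign p) *
        (\<Sum>i\<in>UNIV. M' i h $ p i * (\<Prod>j\<in>UNIV - {i}. M x $ j $ p j)))
      = (\<Sum>i\<in>UNIV. det (row_upd (M x) i (M' i h)))" for h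
  proof -
    have "M' i h $ p i * (\<Prod>j\<in>UNIV - {i}. M x $ j $ p j)
      = (\<Prod>j\<in>UNIV. row_upd (M x) i (M' i h) $ j $ p j)" for i and p :: "'n \<Rightarrow> 'n"
    proof -
      have "(\<Prod>j\<in>UNIV. row_upd (M x) i (M' i h) $ j $ p j)
        = row_upd (M x) i (M' i h) $ i $ p i * (\<Prod>j\<in>UNIV - {i}. row_upd (M x) i (M' i h) $ j $ p j)"
        by (rule prod.remove) auto
      also have "(\<Prod>j\<in>UNIV - {i}. row_upd (M x) i (M' i h) $ j $ p j) = (\<Prod>j\<in>UNIV - {i}. M x $ j $ p j)"
        by (intro prod.cong) (auto simp: row_upd_nth)
      finally show ?thesis
        by (simp add: row_upd_nth)
    qed
    then show ?thesis
      unfolding det_def sum_distrib_left by (subst sum.swap) simp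
  qed
  ultimately show ?thesis
    by simp
qed

lemma continuous_on_det:
  fixes M :: "'a::topological_space \<Rightarrow> real^'n^'n"
  assumes "\<And>i. continuous_on S (\<lambda>x. M x $ i)"
  shows "continuous_on S (\<lambda>x. det (M x))"
  unfolding det_def by (intro continuous_intros assms)

lemma sum_axis_scaleR: "(\<Sum>j\<in>UNIV. (v $ j) *\<^sub>R axis j 1) = (v :: real^'n)"
  using basis_expansion[of v] by (simp add: scalar_mult_eq_scaleR)

text \<open>The rows of the cofactor matrix of a gradient are divergence free: a symmetric Hessian is
  contracted with the antisymmetric form given by the determinant.\<close>

lemma piola_identity:
  fixes M :: "real^'n^'n" and H :: "'n \<Rightarrow> real^'n \<Rightarrow> real^'n"
  assumes sym: "\<And>k v w. H k v \<bullet> w = H k w \<bullet> v"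
  shows "(\<Sum>j\<in>UNIV. \<Sum>k\<in>UNIV.
     det (row_upd (row_upd M i (axis j 1)) k (if k = i then 0 else H k (axis j 1)))) = 0"
proof -
  have "(\<Sum>j\<in>UNIV. det (row_upd (row_upd M i (axis j 1)) k (if k = i then 0 else H k (axis j 1)))) = 0" for k
  proof (cases "k = i")
    case True
    then show ?thesis by (simp add: det_row_upd_zero)
  next
    case False
    define s where "s j l = H k (axis j 1) $ l" for j l
    define B where "B j l = det (row_upd (row_upd M i (axis j 1)) k (axis l 1))" for j l
    have s: "s j l = s l j" for j l
      using sym[of k "axis j 1" "axis l 1"] by (simp add: s_def inner_axis)
    have B: "B j l = - B l j" for j l
      unfolding B_def by (rule det_row_upd_swap) (use False in auto)
    have "det (row_upd (row_upd M i (axis j 1)) k (H k (axis j 1))) = (\<Sum>l\<in>UNIV. s j l * B j l)" for j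
    proof -
      have "det (row_upd (row_upd M i (axis j 1)) k (\<Sum>l\<in>UNIV. (H k (axis j 1) $ l) *\<^sub>R axis l 1))
         = (\<Sum>l\<in>UNIV. s j l * B j l)"
        by (simp add: linear_sum[OF linear_det_row_upd] linear_cmul[OF linear_det_row_upd] s_def B_def)
      then show ?thesis by (simp only: sum_axis_scaleR)
    qed
    then have "(\<Sum>j\<in>UNIV. det (row_upd (row_upd M i (axis j 1)) k (H k (axis j 1))))
        = (\<Sum>j\<in>UNIV. \<Sum>l\<in>UNIV. s j l * B j l)"
      by simp
    moreover have "(\<Sum>j\<in>UNIV. \<Sum>l\<in>UNIV. s j l * B j l) = - (\<Sum>j\<in>UNIV. \<Sum>l\<in>UNIV. s j l * B j l)"
    proof -
      have "(\<Sum>j\<in>UNIV. \<Sum>l\<in>UNIV. s j l * B j l) = (\<Sum>l\<in>UNIV. \<Sum>j\<in>UNIV. s j l * B j l)"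
        by (rule sum.swap)
      also have "\<dots> = (\<Sum>l\<in>UNIV. \<Sum>j\<in>UNIV. - (s l j * B l j))"
        by (intro sum.cong refl) (metis s B mult_minus_right)
      finally show ?thesis by (simp add: sum_negf)
    qed
    ultimately show ?thesis using False by simp
  qed
  then show ?thesis by (subst sum.swap) simp
qed

text \<open>Translation along \<open>v\<close> does not change the integral of a function that
  vanishes off a box. Over one fixed box large enough for all shifts this integral is constant in
  the shift parameter, and it is differentiated under the integral sign at 0.\<close>

lemma integral_directional_derivative_eq_0:
  fixes f :: "'a::euclidean_space \<Rightarrow> real"
  assumes der: "\<And>x. (f has_derivative f' x) (at x)"
    and cont: "continuous_on UNIV (\<lambda>x. f' x v)"
    and supp: "\<And>x. f x \<noteq> 0 \<Longrightarrow> x \<in> cbox a b"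
  shows "integral (cbox a b) (\<lambda>x. f' x v) = 0"
proof -
  \<comment> \<open>\<open>w\<close> has the absolute values of the components of \<open>v\<close>;
    a box enlarged by \<open>w\<close> on every side contains all its translates by multiples of
    \<open>v\<close> with factor between -1 and 1.\<close>
  define w where "w = (\<Sum>i\<in>Basis. \<bar>v \<bullet> i\<bar> *\<^sub>R i)"
  have w: "w \<bullet> i = \<bar>v \<bullet> i\<bar>" if "i \<in> Basis" for i
    using that by (simp add: w_def)
  define Q where "Q = cbox (a - w) (b + w)"
  have sub: "cbox (a - s *\<^sub>R v) (b - s *\<^sub>R v) \<subseteq> Q" if "s \<in> {-1..1}" for s
  proof
    fix x assume x: "x \<in> cbox (a - s *\<^sub>R v) (b - s *\<^sub>R v)"
    show "x \<in> Q"
      unfolding Q_def mem_box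
    proof
      fix i :: 'a assume i: "i \<in> Basis"
      have "\<bar>s * (v \<bullet> i)\<bar> \<le> \<bar>v \<bullet> i\<bar>"
        using that by (auto simp: abs_mult intro!: mult_left_le_one_le)
      moreover have "a \<bullet> i - s * (v \<bullet> i) \<le> x \<bullet> i" "x \<bullet> i \<le> b \<bullet> i - s * (v \<bullet> i)"
        using x i by (auto simp: mem_box inner_simps)
      ultimately show "(a - w) \<bullet> i \<le> x \<bullet> i \<and> x \<bullet> i \<le> (b + w) \<bullet> i"
        unfolding inner_simps w[OF i] by linarith
    qed
  qed
  have contf: "continuous_on UNIV f"
    using der by (meson continuous_at_imp_continuous_on has_derivative_continuous)
  have int: "integral Q (\<lambda>x. f (x + s *\<^sub>R v)) = integral (cbox a b) f" if s: "s \<in> {-1..1}" for s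
  proof -
    have "(f has_integral integral (cbox a b) f) (cbox a b)"
      by (intro integrable_integral integrable_continuous continuous_on_subset[OF contf]) auto
    from has_integral_shift_cbox[OF this, of "s *\<^sub>R v"]
    have "((\<lambda>x. f (x + s *\<^sub>R v)) has_integral integral (cbox a b) f) Q"
    proof (rule has_integral_on_superset)
      show "f (x + s *\<^sub>R v) = 0" if "x \<notin> cbox (a - s *\<^sub>R v) (b - s *\<^sub>R v)" for x
        using that supp[of "x + s *\<^sub>R v"] by (auto simp: mem_box algebra_simps)
    qed (use sub s in auto)
    then show ?thesis by (rule integral_unique)
  qed
  have "((\<lambda>s. integral Q (\<lambda>x. f (x + s *\<^sub>R v))) has_field_derivative
      integral Q (\<lambda>x. f' (x + 0 *\<^sub>R v) v)) (at 0 within {-1..1})"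
    unfolding Q_def
  proof (rule leibniz_rule_field_derivative)
    fix s :: real and x :: 'a
    have "((\<lambda>s. f (x + s *\<^sub>R v)) has_derivative (\<lambda>h. f' (x + s *\<^sub>R v) (h *\<^sub>R v))) (at s within {-1..1})"
      by (rule has_derivative_compose[OF _ der]) (auto intro!: derivative_eq_intros)
    then show "((\<lambda>s. f (x + s *\<^sub>R v)) has_field_derivative f' (x + s *\<^sub>R v) v) (at s within {-1..1})"
      using linear_cmul[OF has_derivative_linear[OF der]]
      by (simp add: has_field_derivative_def mult_commute_abs)
    show "(\<lambda>x. f (x + s *\<^sub>R v)) integrable_on cbox (a - w) (b + w)"
      by (intro integrable_continuous continuous_on_compose2[OF contf] continuous_intros) auto
  next
    show "continuous_on ({-1..1} \<times> cbox (a - w) (b + w)) (\<lambda>(s, x). f' (x + s *\<^sub>R v) v)"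
      unfolding case_prod_beta
      by (intro continuous_on_compose2[OF cont] continuous_intros) auto
  qed auto
  moreover have "((\<lambda>s. integral Q (\<lambda>x. f (x + s *\<^sub>R v))) has_field_derivative 0) (at 0 within {-1..1})"
    by (rule has_field_derivative_transform_within[where d=1 and f = "\<lambda>_. integral (cbox a b) f"])
      (use int in auto)
  ultimately have "integral Q (\<lambda>x. f' x v) = 0"
    by (simp add: at_within_Icc_at DERIV_unique)
  moreover have "integral Q (\<lambda>x. f' x v) = integral (cbox a b) (\<lambda>x. f' x v)"
  proof (rule integral_unique, rule has_integral_on_superset)
    show "((\<lambda>x. f' x v) has_integral integral (cbox a b) (\<lambda>x. f' x v)) (cbox a b)"
      by (intro integrable_integral integrable_continuous continuous_on_subset[OF cont]) auto
    show "f' x v = 0" if "x \<notin> cbox a b" for x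
    proof -
      have "(f has_derivative (\<lambda>_. 0)) (at x)"
        by (rule has_derivative_transform_within_open[where f = "\<lambda>_. 0" and s = "- cbox a b"])
          (use that supp in auto)
      then have "f' x = (\<lambda>_. 0)"
        using der has_derivative_unique by blast
      then show ?thesis by simp
    qed
    show "cbox a b \<subseteq> Q" using sub[of 0] by simp
  qed
  ultimately show ?thesis by simp
qed

text \<open>The integrand is the divergence of the field with components
  \<open>u x * det (row_upd (M x) i (axis j 1))\<close>, that is, of \<open>u\<close> times a
  cofactor row. By \<open>piola_identity\<close> the derivatives of the cofactors cancel and only
  the derivative of \<open>u\<close> remains.\<close>

lemma integral_det_gradient_eq_0:
  fixes M :: "real^'n \<Rightarrow> real^'n^'n" and u :: "real^'n \<Rightarrow> real"
  assumes dM: "\<And>k x. ((\<lambda>x. M x $ k) has_derivative H k x) (at x)"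
    and cH: "\<And>k v. continuous_on UNIV (\<lambda>x. H k x v)"
    and sym: "\<And>k x v w. H k x v \<bullet> w = H k x w \<bullet> v"
    and du: "\<And>x. (u has_derivative (\<lambda>v. Du x \<bullet> v)) (at x)"
    and cDu: "continuous_on UNIV Du"
    and supp: "\<And>x. u x \<noteq> 0 \<Longrightarrow> x \<in> cbox a b"
  shows "integral (cbox a b) (\<lambda>x. det (row_upd (M x) i (Du x))) = 0"
proof -
  have cM: "continuous_on UNIV (\<lambda>x. M x $ k)" for k
    using dM by (meson continuous_at_imp_continuous_on has_derivative_continuous)
  have cu: "continuous_on UNIV u"
    using du by (meson continuous_at_imp_continuous_on has_derivative_continuous)
  define N where "N j x = row_upd (M x) i (axis j 1)" for j x
  \<comment> \<open>Row \<open>i\<close> of \<open>N j x\<close> is the constant vector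
    \<open>axis j 1\<close>, hence the zero for \<open>k = i\<close> in the derivative.\<close>
  define H' where "H' j x v = (\<Sum>k\<in>UNIV. det (row_upd (N j x) k (if k = i then 0 else H k x v)))" for j x v
  define f' where "f' j x v = u x * H' j x v + (Du x \<bullet> v) * det (N j x)" for j x v
  have cN: "continuous_on UNIV (\<lambda>x. N j x $ k)" for j k
    using cM by (cases "k = i") (auto simp: N_def row_upd_nth)
  have dN: "((\<lambda>x. N j x $ k) has_derivative (\<lambda>v. if k = i then 0 else H k x v)) (at x)" for j k x
    using dM by (cases "k = i") (auto simp: N_def row_upd_nth)
  have d: "((\<lambda>x. u x * det (N j x)) has_derivative f' j x) (at x)" for j x
    unfolding f'_def H'_def by (rule has_derivative_mult[OF du has_derivative_det[OF dN]])
  have cf': "continuous_on UNIV (\<lambda>x. f' j x v)" for j v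
  proof -
    have "continuous_on UNIV (\<lambda>x. row_upd (N j x) k (if k = i then 0 else H k x v) $ l)" for k l
      using cN[of j l] cH[of k v] by (cases "l = k"; cases "k = i") (auto simp: row_upd_nth)
    then have "continuous_on UNIV (\<lambda>x. det (row_upd (N j x) k (if k = i then 0 else H k x v)))" for k
      by (rule continuous_on_det)
    moreover have "continuous_on UNIV (\<lambda>x. det (N j x))"
      by (rule continuous_on_det[OF cN])
    ultimately show ?thesis
      unfolding f'_def H'_def by (intro continuous_intros cu cDu)
  qed
  have z: "integral (cbox a b) (\<lambda>x. f' j x (axis j 1)) = 0" for j
    by (rule integral_directional_derivative_eq_0[OF d cf']) (use supp in auto)
  have "det (row_upd (M x) i (Du x)) = (\<Sum>j\<in>UNIV. f' j x (axis j 1))" for x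
  proof -
    have "(\<Sum>j\<in>UNIV. f' j x (axis j 1)) = u x * (\<Sum>j\<in>UNIV. H' j x (axis j 1))
        + (\<Sum>j\<in>UNIV. Du x $ j * det (N j x))"
      by (simp add: f'_def sum.distrib sum_distrib_left inner_axis)
    also have "(\<Sum>j\<in>UNIV. H' j x (axis j 1)) = 0"
      unfolding H'_def N_def by (rule piola_identity[OF sym])
    also have "(\<Sum>j\<in>UNIV. Du x $ j * det (N j x))
        = det (row_upd (M x) i (\<Sum>j\<in>UNIV. (Du x $ j) *\<^sub>R axis j 1))"
      by (simp add: linear_sum[OF linear_det_row_upd] linear_cmul[OF linear_det_row_upd] N_def)
    finally show ?thesis by (simp add: sum_axis_scaleR)
  qed
  moreover have "integral (cbox a b) (\<lambda>x. \<Sum>j\<in>UNIV. f' j x (axis j 1))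
      = (\<Sum>j\<in>UNIV. integral (cbox a b) (\<lambda>x. f' j x (axis j 1)))"
    by (intro integral_sum integrable_continuous continuous_on_subset[OF cf']) auto
  ultimately show ?thesis using z by simp
qed

section \<open>Symmetry of second derivatives\<close>

lemma second_difference_mean_value:
  fixes f :: "'a::real_normed_vector \<Rightarrow> real"
  assumes f: "\<And>x. (f has_derivative f' x) (at x)"
    and fa: "\<And>x. ((\<lambda>x. f' x a) has_derivative fa x) (at x)"
    and t: "t > 0"
  shows "\<exists>p q. 0 < p \<and> p < t \<and> 0 < q \<and> q < t \<and>
    f (x + t *\<^sub>R a + t *\<^sub>R b) - f (x + t *\<^sub>R a) - f (x + t *\<^sub>R b) + f x = t * t * fa (x + p *\<^sub>R a + q *\<^sub>R b) b"
proof -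
  have D: "((\<lambda>s. f (c + s *\<^sub>R a)) has_real_derivative f' (c + s *\<^sub>R a) a) (at s)" for c s
  proof -
    have "((\<lambda>s. f (c + s *\<^sub>R a)) has_derivative (\<lambda>h. f' (c + s *\<^sub>R a) (h *\<^sub>R a))) (at s)"
      by (rule has_derivative_compose[OF _ f]) (auto intro!: derivative_eq_intros)
    then show ?thesis
      using linear_cmul[OF has_derivative_linear[OF f]]
      by (simp add: has_field_derivative_def mult_commute_abs)
  qed
  have Da: "((\<lambda>s. f' (c + s *\<^sub>R b) a) has_real_derivative fa (c + s *\<^sub>R b) b) (at s)" for c s
  proof -
    have "((\<lambda>s. f' (c + s *\<^sub>R b) a) has_derivative (\<lambda>h. fa (c + s *\<^sub>R b) (h *\<^sub>R b))) (at s)"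
      by (rule has_derivative_compose[OF _ fa]) (auto intro!: derivative_eq_intros)
    then show ?thesis
      using linear_cmul[OF has_derivative_linear[OF fa]]
      by (simp add: has_field_derivative_def mult_commute_abs)
  qed
  \<comment> \<open>The mean value theorem is applied to \<open>f\<close> differenced in direction
    \<open>b\<close>, as a function of the position along \<open>a\<close>. The result is a
    difference of \<open>f' _ a\<close> along \<open>b\<close>, to which the theorem applies
    again.\<close>
  have "\<exists>p. 0 < p \<and> p < t \<and> (f (x + t *\<^sub>R b + t *\<^sub>R a) - f (x + t *\<^sub>R a)) - (f (x + t *\<^sub>R b + 0 *\<^sub>R a) - f (x + 0 *\<^sub>R a))
     = (t - 0) * (f' (x + t *\<^sub>R b + p *\<^sub>R a) a - f' (x + p *\<^sub>R a) a)"
    by (rule MVT2[OF t]) (intro DERIV_diff D)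
  then obtain p where p: "0 < p" "p < t" 
    and 1: "(f (x + t *\<^sub>R b + t *\<^sub>R a) - f (x + t *\<^sub>R a)) - (f (x + t *\<^sub>R b + 0 *\<^sub>R a) - f (x + 0 *\<^sub>R a))
     = (t - 0) * (f' (x + t *\<^sub>R b + p *\<^sub>R a) a - f' (x + p *\<^sub>R a) a)" by blast
  have "\<exists>q. 0 < q \<and> q < t \<and> f' ((x + p *\<^sub>R a) + t *\<^sub>R b) a - f' ((x + p *\<^sub>R a) + 0 *\<^sub>R b) a
     = (t - 0) * fa ((x + p *\<^sub>R a) + q *\<^sub>R b) b"
    by (rule MVT2[OF t]) (rule Da)
  then obtain q where q: "0 < q" "q < t" "f' (x + p *\<^sub>R a + t *\<^sub>R b) a - f' (x + p *\<^sub>R a) a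
     = t * fa (x + p *\<^sub>R a + q *\<^sub>R b) b" by auto
  show ?thesis
    using p q 1 by (intro exI[of _ p] exI[of _ q]) (simp add: add_ac)
qed

text \<open>The second difference of \<open>f\<close> over a small parallelogram is symmetric in
  \<open>a\<close> and \<open>b\<close>. Divided by the square of \<open>t\<close> it equals each
  mixed derivative at some point of the parallelogram, and continuity carries the equality to
  \<open>x\<close>.\<close>

lemma symmetric_second_derivative:
  fixes f :: "'a::real_normed_vector \<Rightarrow> real"
  assumes f: "\<And>x. (f has_derivative f' x) (at x)"
    and fa: "\<And>x. ((\<lambda>x. f' x a) has_derivative fa x) (at x)"
    and fb: "\<And>x. ((\<lambda>x. f' x b) has_derivative fb x) (at x)"
    and ca: "continuous_on UNIV (\<lambda>x. fa x b)" and cb: "continuous_on UNIV (\<lambda>x. fb x a)"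
  shows "fa x b = fb x a"
proof (rule ccontr)
  assume ne: "fa x b \<noteq> fb x a"
  define e where "e = dist (fa x b) (fb x a) / 2"
  have e: "e > 0" using ne by (simp add: e_def)
  obtain d1 where d1: "d1 > 0" "\<And>y. dist y x < d1 \<Longrightarrow> dist (fa y b) (fa x b) < e"
    using ca e by (simp add: continuous_on_iff) blast
  obtain d2 where d2: "d2 > 0" "\<And>y. dist y x < d2 \<Longrightarrow> dist (fb y a) (fb x a) < e"
    using cb e by (simp add: continuous_on_iff) blast
  \<comment> \<open>With this \<open>t\<close> every point of the parallelogram is within
    \<open>min d1 d2\<close> of \<open>x\<close>; the 1 in the denominator covers
    \<open>a = b = 0\<close>.\<close>
  define t where "t = min d1 d2 / (norm a + norm b + 1)"
  have pos: "norm a + norm b + 1 > 0" by (simp add: add_nonneg_pos)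
  have t: "t > 0" using d1 d2 pos by (simp add: t_def)
  have close: "dist (x + p *\<^sub>R a + q *\<^sub>R b) x < min d1 d2" if "0 < p" "p < t" "0 < q" "q < t" for p q
  proof -
    have "dist (x + p *\<^sub>R a + q *\<^sub>R b) x = norm (p *\<^sub>R a + q *\<^sub>R b)"
      by (simp add: dist_norm)
    also have "\<dots> \<le> p * norm a + q * norm b"
      using norm_triangle_ineq[of "p *\<^sub>R a" "q *\<^sub>R b"] that by simp
    also have "\<dots> \<le> t * norm a + t * norm b"
      using that by (intro add_mono mult_right_mono) auto
    also have "\<dots> < t * (norm a + norm b + 1)"
      using t by (simp add: algebra_simps)
    also have "\<dots> = min d1 d2"
      using pos by (simp add: t_def)
    finally show ?thesis .
  qed
  obtain p q where pq: "0 < p" "p < t" "0 < q" "q < t"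
    "f (x + t *\<^sub>R a + t *\<^sub>R b) - f (x + t *\<^sub>R a) - f (x + t *\<^sub>R b) + f x = t * t * fa (x + p *\<^sub>R a + q *\<^sub>R b) b"
    using second_difference_mean_value[OF f fa t] by blast
  obtain p' q' where pq': "0 < p'" "p' < t" "0 < q'" "q' < t"
    "f (x + t *\<^sub>R b + t *\<^sub>R a) - f (x + t *\<^sub>R b) - f (x + t *\<^sub>R a) + f x = t * t * fb (x + p' *\<^sub>R b + q' *\<^sub>R a) a"
    using second_difference_mean_value[OF f fb t] by blast
  have "t * t * fa (x + p *\<^sub>R a + q *\<^sub>R b) b = t * t * fb (x + q' *\<^sub>R a + p' *\<^sub>R b) a"
  proof -
    have e1: "x + t *\<^sub>R b + t *\<^sub>R a = x + t *\<^sub>R a + t *\<^sub>R b"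
      and e2: "x + p' *\<^sub>R b + q' *\<^sub>R a = x + q' *\<^sub>R a + p' *\<^sub>R b" by simp_all
    show ?thesis using pq(5) pq'(5)[unfolded e1 e2] by linarith
  qed
  then have "fa (x + p *\<^sub>R a + q *\<^sub>R b) b = fb (x + q' *\<^sub>R a + p' *\<^sub>R b) a"
    using t by simp
  moreover have "dist (fa (x + p *\<^sub>R a + q *\<^sub>R b) b) (fa x b) < e"
    using d1(2) close[of p q] pq by simp
  moreover have "dist (fb (x + q' *\<^sub>R a + p' *\<^sub>R b) a) (fb x a) < e"
    using d2(2) close[of q' p'] pq' by simp
  ultimately show False
    unfolding e_def by (smt (verit) dist_commute dist_triangle field_sum_of_halves)
qed

subsection \<open>Homotopy invariance of the degree integral\<close>

definition jac :: "(real^'n \<Rightarrow> real^'n) \<Rightarrow> real^'n \<Rightarrow> real^'n^'n" where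
  "jac g x = matrix (frechet_derivative g (at x))"

lemma jacobian_eq_det_jac: "jacobian g x = det (jac g x)"
  by (simp add: jacobian_def jac_def)

lemma has_derivative_jac:
  assumes "(g has_derivative g') (at x)"
  shows "jac g x = matrix g'"
  using frechet_derivative_at[OF assms] by (simp add: jac_def)

lemma C_order_SucD: "C_order (Suc k) f \<Longrightarrow> C_order k f"
proof (induction k arbitrary: f)
  case 0
  then show ?case
    by (auto intro!: continuous_at_imp_continuous_on dest: has_derivative_continuous)
next
  case (Suc k)
  obtain f' where f': "\<And>x. (f has_derivative f' x) (at x)" "\<And>h. C_order (Suc k) (\<lambda>x. f' x h)"
    using Suc.prems unfolding C_order.simps(2)[of "Suc k" f] by blast
  then show ?case
    unfolding C_order.simps(2)[of k f] using Suc.IH by blast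
qed

lemma C_order_affine:
  assumes "C_order k f" "C_order k g"
  shows "C_order k (\<lambda>x. f x + c *\<^sub>R g x)"
  using assms
proof (induction k arbitrary: f g)
  case 0
  then show ?case by (auto intro!: continuous_intros)
next
  case (Suc k)
  obtain f' where f': "\<And>x. (f has_derivative f' x) (at x)" "\<And>h. C_order k (\<lambda>x. f' x h)"
    using Suc.prems(1) unfolding C_order.simps by blast
  obtain g' where g': "\<And>x. (g has_derivative g' x) (at x)" "\<And>h. C_order k (\<lambda>x. g' x h)"
    using Suc.prems(2) unfolding C_order.simps by blast
  show ?case
    unfolding C_order.simps
    by (rule exI[of _ "\<lambda>x h. f' x h + c *\<^sub>R g' x h"])
      (use Suc.IH f' g' in \<open>auto intro!: derivative_eq_intros\<close>)
qed

lemma smooth_C_order: "smooth g \<Longrightarrow> C_order k g"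
  by (simp add: smooth_def)

text \<open>\<open>C_order\<close> speaks of one direction \<open>h\<close> at a time. Here the
  derivatives along the coordinate axes are assembled into the rows of the Jacobian matrix and into
  \<open>H k x\<close>, the Hessian of component \<open>k\<close>, whose symmetry on basis vectors
  extends by bilinearity.\<close>

lemma C_order_2_jac:
  fixes g :: "real^'n \<Rightarrow> real^'n"
  assumes "C_order 2 g"
  obtains H where "\<And>x. (g has_derivative (\<lambda>v. jac g x *v v)) (at x)"
    "\<And>k x. ((\<lambda>x. jac g x $ k) has_derivative H k x) (at x)"
    "\<And>k v. continuous_on UNIV (\<lambda>x. H k x v)"
    "\<And>k x v w. H k x v \<bullet> w = H k x w \<bullet> v"
proof -
  have "C_order (Suc 1) g"
    using assms unfolding numeral_2_eq_2 One_nat_def .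
  then obtain g' where g': "\<And>x. (g has_derivative g' x) (at x)" "\<And>h. C_order 1 (\<lambda>x. g' x h)"
    unfolding C_order.simps(2) by blast
  have "\<forall>h. \<exists>f'. (\<forall>x. ((\<lambda>x. g' x h) has_derivative f' x) (at x)) \<and> (\<forall>v. continuous_on UNIV (\<lambda>x. f' x v))"
    using g'(2) unfolding One_nat_def C_order.simps by blast
  then obtain g2 where g2: "\<And>h x. ((\<lambda>x. g' x h) has_derivative g2 h x) (at x)"
      "\<And>h v. continuous_on UNIV (\<lambda>x. g2 h x v)"
    using choice[of "\<lambda>h f'. (\<forall>x. ((\<lambda>x. g' x h) has_derivative f' x) (at x)) \<and>
      (\<forall>v. continuous_on UNIV (\<lambda>x. f' x v))"] by blast
  have jac: "jac g x = matrix (g' x)" for x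
    by (rule has_derivative_jac[OF g'(1)])
  have lin: "linear (g' x)" for x
    by (rule has_derivative_linear[OF g'(1)])
  define H where "H k x v = (\<chi> j. g2 (axis j 1) x v $ k)" for k x v
  have jack: "jac g x $ k = (\<chi> j. g' x (axis j 1) $ k)" for x k
    by (simp add: jac matrix_def)
  have d0: "((\<lambda>x. g x $ k) has_derivative (\<lambda>v. g' x v $ k)) (at x)" for k x
    by (rule bounded_linear.has_derivative[OF bounded_linear_vec_nth g'(1)])
  have d1: "((\<lambda>x. g' x v $ k) has_derivative (\<lambda>w. g2 v x w $ k)) (at x)" for k x v
    by (rule bounded_linear.has_derivative[OF bounded_linear_vec_nth g2(1)])
  have c2: "continuous_on UNIV (\<lambda>x. g2 v x w $ k)" for k v w
    by (intro continuous_intros g2)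
  have sym: "g2 (axis j 1) x (axis l 1) $ k = g2 (axis l 1) x (axis j 1) $ k" for j l k x
    by (rule symmetric_second_derivative[OF d0 d1 d1 c2 c2])
  have dH: "((\<lambda>x. jac g x $ k) has_derivative H k x) (at x)" for k x
    unfolding H_def jack
  proof (subst has_derivative_componentwise_within, intro ballI)
    fix b :: "real^'n" assume "b \<in> Basis"
    then obtain j where b: "b = axis j 1"
      by (auto simp: Basis_vec_def)
    show "((\<lambda>x. (\<chi> j. g' x (axis j 1) $ k) \<bullet> b) has_derivative
        (\<lambda>v. (\<chi> j. g2 (axis j 1) x v $ k) \<bullet> b)) (at x)"
      unfolding b inner_axis using d1 by simp
  qed
  have linH: "linear (H k x)" for k x
    by (rule has_derivative_linear[OF dH])
  show thesis
  proof
    show "(g has_derivative (\<lambda>v. jac g x *v v)) (at x)" for x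
      unfolding jac matrix_vector_mul(2)[OF lin] by (rule g'(1))
    show "((\<lambda>x. jac g x $ k) has_derivative H k x) (at x)" for k x
      by (rule dH)
    show "continuous_on UNIV (\<lambda>x. H k x v)" for k v
      unfolding H_def by (intro continuous_on_vec_lambda c2)
    show "H k x v \<bullet> w = H k x w \<bullet> v" for k x v w
    proof -
      have comp: "H k x v $ j = (\<Sum>l\<in>UNIV. v $ l * H k x (axis l 1) $ j)" for v j
      proof -
        have "H k x (\<Sum>l\<in>UNIV. (v $ l) *\<^sub>R axis l 1) $ j = (\<Sum>l\<in>UNIV. v $ l * H k x (axis l 1) $ j)"
          by (simp add: linear_sum[OF linH] linear_cmul[OF linH])
        then show ?thesis by (simp only: sum_axis_scaleR)
      qed
      have e: "H k x v \<bullet> w = (\<Sum>j\<in>UNIV. \<Sum>l\<in>UNIV. v $ l * H k x (axis l 1) $ j * w $ j)" for v w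
        unfolding inner_vec_def inner_real_def
        by (rule sum.cong[OF refl], subst comp) (rule sum_distrib_right)
      have "H k x v \<bullet> w = (\<Sum>l\<in>UNIV. \<Sum>j\<in>UNIV. v $ l * H k x (axis l 1) $ j * w $ j)"
        unfolding e by (rule sum.swap)
      also have "\<dots> = H k x w \<bullet> v"
        unfolding e
      proof (intro sum.cong refl)
        fix l j
        show "v $ l * H k x (axis l 1) $ j * w $ j = w $ j * H k x (axis j 1) $ l * v $ l"
          using sym[of l x j k] by (simp add: H_def)
      qed
      finally show ?thesis .
    qed
  qed
qed

lemma C_order_2_has_derivative:
  fixes g :: "real^'n \<Rightarrow> real^'n"
  assumes "C_order 2 g"
  shows "(g has_derivative (\<lambda>v. jac g x *v v)) (at x)"
  by (rule C_order_2_jac[OF assms]) blast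

lemma C_order_2_continuous:
  fixes g :: "real^'n \<Rightarrow> real^'n"
  assumes "C_order 2 g"
  shows "continuous_on UNIV g"
  using C_order_2_has_derivative[OF assms]
  by (meson continuous_at_imp_continuous_on has_derivative_continuous)

lemma C_order_2_continuous_jac:
  fixes g :: "real^'n \<Rightarrow> real^'n"
  assumes "C_order 2 g"
  shows "continuous_on UNIV (\<lambda>x. jac g x $ k)"
proof (rule C_order_2_jac[OF assms])
  fix H :: "'n \<Rightarrow> real^'n \<Rightarrow> real^'n \<Rightarrow> real^'n"
  assume "\<And>k x. ((\<lambda>x. jac g x $ k) has_derivative H k x) (at x)"
  then show ?thesis
    by (meson continuous_at_imp_continuous_on has_derivative_continuous)
qed

lemma jac_affine:
  fixes f g :: "real^'n \<Rightarrow> real^'n"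
  assumes "C_order 2 f" "C_order 2 g"
  shows "jac (\<lambda>x. f x + c *\<^sub>R g x) x = jac f x + c *\<^sub>R jac g x"
proof -
  have "((\<lambda>x. f x + c *\<^sub>R g x) has_derivative (\<lambda>v. jac f x *v v + c *\<^sub>R (jac g x *v v))) (at x)"
    by (intro derivative_intros C_order_2_has_derivative assms)
  then have "jac (\<lambda>x. f x + c *\<^sub>R g x) x = matrix (\<lambda>v. jac f x *v v + c *\<^sub>R (jac g x *v v))"
    by (rule has_derivative_jac)
  also have "\<dots> = jac f x + c *\<^sub>R jac g x"
    by (simp add: matrix_def vec_eq_iff matrix_vector_mult_basis column_def)
  finally show ?thesis .
qed

text \<open>The square makes \<open>max 0\<close> continuously differentiable across the sphere of
  radius \<open>r\<close>, which is the regularity that the homotopy argument asks of the kernel.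
  There is no normalising factor; the total mass is \<open>bump_mass\<close>.\<close>

definition bump :: "real \<Rightarrow> 'a::euclidean_space \<Rightarrow> real" where
  "bump r v = (max 0 (r\<^sup>2 - v \<bullet> v))\<^sup>2"

definition grad_bump :: "real \<Rightarrow> 'a::euclidean_space \<Rightarrow> 'a" where
  "grad_bump r v = (- 4 * max 0 (r\<^sup>2 - v \<bullet> v)) *\<^sub>R v"

lemma has_derivative_max_0_square:
  "((\<lambda>s::real. (max 0 s)\<^sup>2) has_real_derivative 2 * max 0 s) (at s)"
proof (cases s "0::real" rule: linorder_cases)
  case less
  have "((\<lambda>s::real. 0) has_real_derivative 0) (at s)" by simp
  then have "((\<lambda>s::real. (max 0 s)\<^sup>2) has_real_derivative 0) (at s)"
    by (rule has_field_derivative_transform_within_open[where S = "{..<0}"]) (use less in \<open>auto simp: max_def\<close>)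
  then show ?thesis using less by simp
next
  case greater
  have "((\<lambda>s::real. s\<^sup>2) has_real_derivative 2 * s) (at s)"
    by (auto intro!: derivative_eq_intros)
  then have "((\<lambda>s::real. (max 0 s)\<^sup>2) has_real_derivative 2 * s) (at s)"
    by (rule has_field_derivative_transform_within_open[where S = "{0<..}"]) (use greater in \<open>auto simp: max_def\<close>)
  then show ?thesis using greater by simp
next
  case equal
  have "((\<lambda>h::real. (max 0 h)\<^sup>2 / h) \<longlongrightarrow> 0) (at 0)"
  proof (rule Lim_null_comparison)
    show "\<forall>\<^sub>F h::real in at 0. norm ((max 0 h)\<^sup>2 / h) \<le> \<bar>h\<bar>"
      by (rule always_eventually) (auto simp: max_def power2_eq_square)
    show "((\<lambda>h::real. \<bar>h\<bar>) \<longlongrightarrow> 0) (at 0)"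
      by (auto intro!: tendsto_eq_intros)
  qed
  then show ?thesis using equal by (simp add: DERIV_def)
qed

lemma has_derivative_bump: "(bump r has_derivative (\<lambda>h. grad_bump r v \<bullet> h)) (at v)"
proof -
  have "((\<lambda>v. r\<^sup>2 - v \<bullet> v) has_derivative (\<lambda>h. - 2 * (v \<bullet> h))) (at v)"
    by (auto intro!: derivative_eq_intros simp: inner_commute)
  from has_derivative_compose[OF this has_derivative_max_0_square[unfolded has_field_derivative_def]]
  show ?thesis
    by (simp add: bump_def[abs_def] grad_bump_def mult_ac)
qed

lemma continuous_on_grad_bump: "continuous_on S (grad_bump r)"
  unfolding grad_bump_def by (intro continuous_intros)

lemma continuous_on_bump: "continuous_on S (bump r)"
  unfolding bump_def by (intro continuous_intros)

lemma bump_eq_0: "r \<ge> 0 \<Longrightarrow> norm v \<ge> r \<Longrightarrow> bump r v = 0" "r \<ge> 0 \<Longrightarrow> norm v \<ge> r \<Longrightarrow> grad_bump r v = 0"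
  using power_mono[of r "norm v" 2] by (simp_all add: bump_def grad_bump_def power2_norm_eq_inner)

lemma bump_nonneg: "bump r v \<ge> 0"
  by (simp add: bump_def)

lemma bump_pos: "norm v < r \<Longrightarrow> bump r v > 0"
  using power_strict_mono[of "norm v" r 2] by (simp add: bump_def power2_norm_eq_inner)

text \<open>A point outside \<open>A\<close> is either exterior or on the frontier, where
  \<open>N x > r\<close> and hence \<open>f\<close> vanishes nearby. Extension by zero therefore
  creates no singularity. In the application \<open>N\<close> is the distance of the homotopy from
  \<open>z\<close>.\<close>

lemma has_derivative_cutoff:
  fixes f :: "'a::real_normed_vector \<Rightarrow> 'b::real_normed_vector"
  assumes A: "open A" and N: "continuous_on UNIV N"
    and fr: "\<And>x. x \<in> frontier A \<Longrightarrow> N x > (r::real)" and f0: "\<And>x. N x > r \<Longrightarrow> f x = 0"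
    and f: "(f has_derivative f') (at x)"
  shows "((\<lambda>x. if x \<in> A then f x else 0) has_derivative (if x \<in> A then f' else (\<lambda>_. 0))) (at x)"
proof (cases "x \<in> A")
  case True
  then have "((\<lambda>x. if x \<in> A then f x else 0) has_derivative f') (at x)"
    by (intro has_derivative_transform_within_open[OF f A]) auto
  then show ?thesis using True by simp
next
  case False
  have "((\<lambda>x. if x \<in> A then f x else 0) has_derivative (\<lambda>_. 0)) (at x)"
  proof (rule has_derivative_transform_within_open)
    show "((\<lambda>_. 0) has_derivative (\<lambda>_. 0)) (at x)" by simp
    show "open (- closure A \<union> {x. N x > r})"
      using N by (intro open_Un open_Collect_less) auto
    show "x \<in> - closure A \<union> {x. N x > r}"
      using False fr A by (auto simp: frontier_def interior_open)
    show "0 = (if x \<in> A then f x else 0)" if "x \<in> - closure A \<union> {x. N x > r}" for x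
      using that closure_subset f0 by auto
  qed
  then show ?thesis using False by simp
qed

text \<open>The cutoff with a parameter. \<open>T\<close> will be a closed interval, so the two sets
  on which the function is visibly continuous are open only relative to
  \<open>T \<times> UNIV\<close>.\<close>

lemma continuous_on_cutoff:
  fixes F :: "'a::metric_space \<times> 'b::metric_space \<Rightarrow> 'c::real_normed_vector"
  assumes F: "continuous_on (T \<times> UNIV) F" and N: "continuous_on (T \<times> UNIV) N" and A: "open A"
    and fr: "\<And>t x. t \<in> T \<Longrightarrow> x \<in> frontier A \<Longrightarrow> N (t, x) > (r::real)"
    and F0: "\<And>t x. t \<in> T \<Longrightarrow> N (t, x) > r \<Longrightarrow> F (t, x) = 0"
  shows "continuous_on (T \<times> UNIV) (\<lambda>p. if snd p \<in> A then F p else 0)"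
proof -
  let ?X = "T \<times> (UNIV :: 'b set)"
  define S1 where "S1 = ?X \<inter> snd -` A"
  define S2 where "S2 = (?X \<inter> snd -` (- closure A)) \<union> (?X \<inter> N -` {r<..})"
  have X: "?X = S1 \<union> S2"
    using A fr by (auto simp: S1_def S2_def frontier_def interior_open)
  have "continuous_on (S1 \<union> S2) (\<lambda>p. if snd p \<in> A then F p else 0)"
  proof (rule continuous_on_Un_local_open)
    show "openin (top_of_set (S1 \<union> S2)) S1"
      unfolding X[symmetric] unfolding S1_def
      by (rule continuous_openin_preimage_gen) (auto intro!: continuous_intros A)
    show "openin (top_of_set (S1 \<union> S2)) S2"
      unfolding X[symmetric] unfolding S2_def
      by (intro openin_Un continuous_openin_preimage_gen) (auto intro!: continuous_intros N)
    show "continuous_on S1 (\<lambda>p. if snd p \<in> A then F p else 0)"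
      by (rule continuous_on_eq[where f = F]) (auto simp: S1_def intro: continuous_on_subset[OF F])
    show "continuous_on S2 (\<lambda>p. if snd p \<in> A then F p else 0)"
      by (rule continuous_on_eq[where f = "\<lambda>_. 0"])
        (use F0 closure_subset in \<open>auto simp: S2_def\<close>)
  qed
  then show ?thesis using X by simp
qed

text \<open>This is the integral over \<open>A\<close> of the pullback under \<open>g\<close> of the
  volume form with density \<open>bump r (v - z)\<close>.\<close>

definition deg_integral :: "real \<Rightarrow> (real^'n \<Rightarrow> real^'n) \<Rightarrow> (real^'n) set \<Rightarrow> real^'n \<Rightarrow> real" where
  "deg_integral r g A z = integral A (\<lambda>x. bump r (g x - z) * jacobian g x)"

lemma deg_integral_homotopy:
  fixes g h :: "real^'n \<Rightarrow> real^'n"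
  assumes A: "open A" "bounded A" and r: "r > 0"
    and g: "C_order 2 g" and h: "C_order 2 h"
    and fr: "\<And>t x. t \<in> {0..1} \<Longrightarrow> x \<in> frontier A \<Longrightarrow> norm (g x + t *\<^sub>R h x - z) > r"
  shows "deg_integral r (\<lambda>x. g x + h x) A z = deg_integral r g A z"
proof -
  obtain a where a: "A \<subseteq> cbox (-a) a"
    using bounded_subset_cbox_symmetric[OF A(2)] by blast
  let ?Q = "cbox (-a) a" and ?T = "{0..1::real}"
  define G where "G t x = g x + t *\<^sub>R h x - z" for t x
  define J where "J t x = jac g x + t *\<^sub>R jac h x" for t x
  obtain Hg where Hg: "\<And>x. (g has_derivative (\<lambda>v. jac g x *v v)) (at x)"
    "\<And>k x. ((\<lambda>x. jac g x $ k) has_derivative Hg k x) (at x)"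
    "\<And>k v. continuous_on UNIV (\<lambda>x. Hg k x v)"
    "\<And>k x v w. Hg k x v \<bullet> w = Hg k x w \<bullet> v"
    using C_order_2_jac[OF g] by blast
  obtain Hh where Hh: "\<And>x. (h has_derivative (\<lambda>v. jac h x *v v)) (at x)"
    "\<And>k x. ((\<lambda>x. jac h x $ k) has_derivative Hh k x) (at x)"
    "\<And>k v. continuous_on UNIV (\<lambda>x. Hh k x v)"
    "\<And>k x v w. Hh k x v \<bullet> w = Hh k x w \<bullet> v"
    using C_order_2_jac[OF h] by blast
  note cg = C_order_2_continuous[OF g] and ch = C_order_2_continuous[OF h]
  note cjg = C_order_2_continuous_jac[OF g] and cjh = C_order_2_continuous_jac[OF h]
  have cgs: "continuous_on (?T \<times> UNIV) (\<lambda>p. g (snd p))" 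
    by (intro continuous_on_compose2[OF cg] continuous_intros) auto
  have chs: "continuous_on (?T \<times> UNIV) (\<lambda>p. h (snd p))" 
    by (intro continuous_on_compose2[OF ch] continuous_intros) auto
  have cG: "continuous_on (?T \<times> UNIV) (\<lambda>p. G (fst p) (snd p))"
    unfolding G_def by (intro continuous_intros cgs chs)
  have cjgs: "continuous_on (?T \<times> UNIV) (\<lambda>p. jac g (snd p) $ k)" for k
    by (intro continuous_on_compose2[OF cjg] continuous_intros) auto
  have cjhs: "continuous_on (?T \<times> UNIV) (\<lambda>p. jac h (snd p) $ k)" for k
    by (intro continuous_on_compose2[OF cjh] continuous_intros) auto
  have cJ: "continuous_on (?T \<times> UNIV) (\<lambda>p. J (fst p) (snd p) $ k)" for k
    unfolding J_def vector_add_component vector_scaleR_component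
    by (intro continuous_intros cjgs cjhs)
  \<comment> \<open>\<open>F\<close> is the derivative in \<open>t\<close> of
    \<open>bump r (G t x) * det (J t x)\<close>, by the chain rule on the kernel and the row-wise
    derivative of the determinant. \<open>F'\<close> and \<open>P\<close> extend this derivative and
    the integrand itself by zero.\<close>
  define F where "F p = (let t = fst p; x = snd p in
     (grad_bump r (G t x) \<bullet> h x) * det (J t x)
      + bump r (G t x) * (\<Sum>i\<in>UNIV. det (row_upd (J t x) i (jac h x $ i))))" for p
  define F' where "F' t x = (if x \<in> A then F (t, x) else 0)" for t x
  define P where "P t x = (if x \<in> A then bump r (G t x) * det (J t x) else 0)" for t x
  have cN: "continuous_on (?T \<times> UNIV) (\<lambda>p. norm (G (fst p) (snd p)))"
    by (intro continuous_intros cG)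
  have frN: "r < norm (G (fst (t, x)) (snd (t, x)))" if "t \<in> ?T" "x \<in> frontier A" for t x
    using fr that by (simp add: G_def)
  have cdetu: "continuous_on (?T \<times> UNIV) (\<lambda>p. det (row_upd (J (fst p) (snd p)) i (jac h (snd p) $ i)))" for i
  proof (rule continuous_on_det)
    show "continuous_on (?T \<times> UNIV) (\<lambda>p. row_upd (J (fst p) (snd p)) i (jac h (snd p) $ i) $ k)" for k
      using cJ[of k] cjhs[of i] by (cases "k = i") (auto simp: row_upd_nth)
  qed
  have cF: "continuous_on (?T \<times> UNIV) F"
    unfolding F_def Let_def
    by (intro continuous_intros continuous_on_det cJ cG chs cdetu
        continuous_on_compose2[OF continuous_on_grad_bump[of UNIV]]
        continuous_on_compose2[OF continuous_on_bump[of UNIV]]) auto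
  have cF': "continuous_on (?T \<times> UNIV) (\<lambda>p. if snd p \<in> A then F p else 0)"
    by (rule continuous_on_cutoff[OF cF cN A(1) frN])
      (use r in \<open>auto simp: F_def bump_eq_0\<close>)
  have cP: "continuous_on UNIV (P t)" if t: "t \<in> ?T" for t
  proof -
    have "continuous_on (?T \<times> UNIV) (\<lambda>p. bump r (G (fst p) (snd p)) * det (J (fst p) (snd p)))"
      by (intro continuous_intros continuous_on_det cJ cG
          continuous_on_compose2[OF continuous_on_bump[of UNIV]]) auto
    then have "continuous_on (?T \<times> UNIV)
      (\<lambda>p. if snd p \<in> A then bump r (G (fst p) (snd p)) * det (J (fst p) (snd p)) else 0)"
      by (rule continuous_on_cutoff[OF _ cN A(1) frN]) (use r in \<open>auto simp: bump_eq_0\<close>)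
    from continuous_on_compose2[OF this, of UNIV "\<lambda>x. (t, x)"]
    show ?thesis using t by (simp add: P_def[abs_def] continuous_on_Pair image_subset_iff cong: if_cong)
  qed
  have dP: "((\<lambda>t. P t x) has_field_derivative F' t x) (at t within ?T)" for t x
  proof (cases "x \<in> A")
    case True
    have dG: "((\<lambda>t. G t x) has_derivative (\<lambda>s. s *\<^sub>R h x)) (at t within ?T)"
      unfolding G_def by (auto intro!: derivative_eq_intros)
    have dJ: "((\<lambda>t. J t x $ i) has_derivative (\<lambda>s. s *\<^sub>R jac h x $ i)) (at t within ?T)" for i
      unfolding J_def vector_add_component vector_scaleR_component by (auto intro!: derivative_eq_intros)
    have "((\<lambda>t. bump r (G t x) * det (J t x)) has_derivative
        (\<lambda>s. bump r (G t x) * (\<Sum>i\<in>UNIV. det (row_upd (J t x) i (s *\<^sub>R jac h x $ i)))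
         + (grad_bump r (G t x) \<bullet> (s *\<^sub>R h x)) * det (J t x))) (at t within ?T)"
      by (rule has_derivative_mult[OF has_derivative_compose[OF dG has_derivative_bump] has_derivative_det[OF dJ]])
    moreover have "bump r (G t x) * (\<Sum>i\<in>UNIV. det (row_upd (J t x) i (s *\<^sub>R jac h x $ i)))
         + (grad_bump r (G t x) \<bullet> (s *\<^sub>R h x)) * det (J t x) = F (t, x) * s" for s
      by (simp add: F_def linear_cmul[OF linear_det_row_upd] algebra_simps sum_distrib_left)
    ultimately show ?thesis
      using True by (simp add: P_def F'_def has_field_derivative_def mult_commute_abs)
  next
    case False
    then show ?thesis by (simp add: P_def F'_def)
  qed
  have I0: "integral ?Q (F' t) = 0" if t: "t \<in> ?T" for t
  proof -
    \<comment> \<open>\<open>u i\<close> is component \<open>i\<close> of the velocity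
      \<open>h\<close>, weighted by the kernel and cut off at the frontier, and \<open>Du i\<close>
      is its gradient. Putting \<open>Du i\<close> into row \<open>i\<close> of \<open>J t x\<close>
      gives the Jacobian matrix of \<open>G t\<close> with component \<open>i\<close> replaced by
      \<open>u i\<close>.\<close>
    define u where "u i x = (if x \<in> A then bump r (G t x) * h x $ i else 0)" for i x
    define Du where "Du i x = (if x \<in> A then (h x $ i) *\<^sub>R (\<Sum>k\<in>UNIV. (grad_bump r (G t x) $ k) *\<^sub>R J t x $ k)
       + bump r (G t x) *\<^sub>R jac h x $ i else 0)" for i x
    have N1: "continuous_on UNIV (\<lambda>x. norm (G t x))"
      unfolding G_def by (intro continuous_intros cg ch)
    have fr1: "r < norm (G t x)" if "x \<in> frontier A" for x
      using fr t that by (simp add: G_def)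
    have dJ: "((\<lambda>x. J t x $ k) has_derivative (\<lambda>v. Hg k x v + t *\<^sub>R Hh k x v)) (at x)" for k x
      unfolding J_def vector_add_component vector_scaleR_component
      by (intro derivative_intros Hg Hh)
    have dG: "((\<lambda>x. G t x) has_derivative (\<lambda>v. J t x *v v)) (at x)" for x
    proof -
      have "((\<lambda>x. G t x) has_derivative (\<lambda>v. jac g x *v v + t *\<^sub>R (jac h x *v v) - 0)) (at x)"
        unfolding G_def by (intro derivative_intros Hg Hh)
      then show ?thesis
        by (simp add: J_def matrix_vector_mult_add_rdistrib scaleR_matrix_vector_assoc)
    qed
    have du: "(u i has_derivative (\<lambda>v. Du i x \<bullet> v)) (at x)" for i x
    proof -
      have "((\<lambda>x. h x $ i) has_derivative (\<lambda>v. (jac h x *v v) $ i)) (at x)"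
        by (rule bounded_linear.has_derivative[OF bounded_linear_vec_nth Hh(1)])
      then have "((\<lambda>x. bump r (G t x) * h x $ i) has_derivative
         (\<lambda>v. bump r (G t x) * (jac h x *v v) $ i + (grad_bump r (G t x) \<bullet> (J t x *v v)) * h x $ i)) (at x)"
        by (rule has_derivative_mult[OF has_derivative_compose[OF dG has_derivative_bump]])
      from has_derivative_cutoff[OF A(1) N1 fr1 _ this]
      have "((\<lambda>x. if x \<in> A then bump r (G t x) * h x $ i else 0) has_derivative 
         (if x \<in> A then (\<lambda>v. bump r (G t x) * (jac h x *v v) $ i + (grad_bump r (G t x) \<bullet> (J t x *v v)) * h x $ i)
           else (\<lambda>_. 0))) (at x)"
        using r by (auto simp: bump_eq_0)
      moreover have "(if x \<in> A then (\<lambda>v. bump r (G t x) * (jac h x *v v) $ i + (grad_bump r (G t x) \<bullet> (J t x *v v)) * h x $ i)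
           else (\<lambda>_. 0)) = (\<lambda>v. Du i x \<bullet> v)"
        by (auto simp: Du_def fun_eq_iff inner_simps inner_sum_left matrix_vector_mul_component 
            inner_vec_def[of "grad_bump r (G t x)"])
      ultimately show ?thesis by (simp add: u_def[abs_def])
    qed
    have cDu: "continuous_on UNIV (Du i)" for i
    proof -
      have "continuous_on (?T \<times> UNIV) (\<lambda>p. (h (snd p) $ i) *\<^sub>R
          (\<Sum>k\<in>UNIV. (grad_bump r (G (fst p) (snd p)) $ k) *\<^sub>R J (fst p) (snd p) $ k)
         + bump r (G (fst p) (snd p)) *\<^sub>R jac h (snd p) $ i)"
        by (intro continuous_intros cJ cG chs cjhs
          continuous_on_compose2[OF continuous_on_grad_bump[of UNIV]]
          continuous_on_compose2[OF continuous_on_bump[of UNIV]]) auto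
      then have "continuous_on (?T \<times> UNIV) (\<lambda>p. if snd p \<in> A then (h (snd p) $ i) *\<^sub>R
          (\<Sum>k\<in>UNIV. (grad_bump r (G (fst p) (snd p)) $ k) *\<^sub>R J (fst p) (snd p) $ k)
         + bump r (G (fst p) (snd p)) *\<^sub>R jac h (snd p) $ i else 0)"
        by (rule continuous_on_cutoff[OF _ cN A(1) frN]) (use r in \<open>auto simp: bump_eq_0\<close>)
      from continuous_on_compose2[OF this, of UNIV "\<lambda>x. (t, x)"]
      show ?thesis using t by (simp add: Du_def[abs_def] continuous_on_Pair image_subset_iff cong: if_cong)
    qed
    have z: "integral ?Q (\<lambda>x. det (row_upd (J t x) i (Du i x))) = 0" for i
    proof (rule integral_det_gradient_eq_0[OF dJ _ _ du cDu])
      show "continuous_on UNIV (\<lambda>x. Hg k x v + t *\<^sub>R Hh k x v)" for k v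
        by (intro continuous_intros Hg Hh)
      show "(Hg k x v + t *\<^sub>R Hh k x v) \<bullet> w = (Hg k x w + t *\<^sub>R Hh k x w) \<bullet> v" for k x v w
        using Hg(4)[of k x v w] Hh(4)[of k x v w] by (simp add: inner_simps)
      show "x \<in> ?Q" if "u i x \<noteq> 0" for x
        using that a by (auto simp: u_def split: if_splits)
    qed
    have cJt: "continuous_on UNIV (\<lambda>x. J t x $ k)" for k
      using dJ by (meson continuous_at_imp_continuous_on has_derivative_continuous)
    have cdet: "continuous_on UNIV (\<lambda>x. det (row_upd (J t x) i (Du i x)))" for i
    proof (rule continuous_on_det)
      show "continuous_on UNIV (\<lambda>x. row_upd (J t x) i (Du i x) $ k)" for k
        using cJt[of k] cDu[of i] by (cases "k = i") (auto simp: row_upd_nth)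
    qed
    have "F' t x = (\<Sum>i\<in>UNIV. det (row_upd (J t x) i (Du i x)))" for x
    proof (cases "x \<in> A")
      case True
      have "det (row_upd (J t x) i (Du i x)) = h x $ i * grad_bump r (G t x) $ i * det (J t x)
          + bump r (G t x) * det (row_upd (J t x) i (jac h x $ i))" for i
      proof -
        have "det (row_upd (J t x) i (\<Sum>k\<in>UNIV. (grad_bump r (G t x) $ k) *\<^sub>R J t x $ k))
           = (\<Sum>k\<in>UNIV. grad_bump r (G t x) $ k * det (row_upd (J t x) i (J t x $ k)))"
          by (simp add: linear_sum[OF linear_det_row_upd] linear_cmul[OF linear_det_row_upd])
        \<comment> \<open>Row \<open>k\<close> of \<open>J t x\<close> placed in row
          \<open>i\<close> duplicates a row unless \<open>k = i\<close>, so a single term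
          survives.\<close>
        also have "\<dots> = (\<Sum>k\<in>UNIV. if k = i then grad_bump r (G t x) $ i * det (J t x) else 0)"
          by (intro sum.cong) (auto simp: det_row_upd_other row_upd_same)
        finally show ?thesis
          using True by (simp add: Du_def linear_add[OF linear_det_row_upd] linear_cmul[OF linear_det_row_upd])
      qed
      then show ?thesis
        using True by (simp add: F'_def F_def sum.distrib sum_distrib_left sum_distrib_right inner_vec_def mult_ac)
    next
      case False
      then show ?thesis by (simp add: F'_def Du_def det_row_upd_zero)
    qed
    then have "F' t = (\<lambda>x. \<Sum>i\<in>UNIV. det (row_upd (J t x) i (Du i x)))"
      by (rule ext)
    moreover have "integral ?Q (\<lambda>x. \<Sum>i\<in>UNIV. det (row_upd (J t x) i (Du i x)))
        = (\<Sum>i\<in>UNIV. integral ?Q (\<lambda>x. det (row_upd (J t x) i (Du i x))))"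
      by (intro integral_sum integrable_continuous continuous_on_subset[OF cdet]) auto
    ultimately show ?thesis using z by simp
  qed
  have D: "((\<lambda>t. integral ?Q (P t)) has_field_derivative integral ?Q (F' t)) (at t within ?T)"
    if t: "t \<in> ?T" for t
  proof (rule leibniz_rule_field_derivative[OF dP _ _ t])
    show "P t integrable_on ?Q" if "t \<in> ?T" for t
      by (intro integrable_continuous continuous_on_subset[OF cP[OF that]]) auto
    show "continuous_on (?T \<times> ?Q) (\<lambda>(t, x). F' t x)"
      using continuous_on_subset[OF cF', of "?T \<times> ?Q"] by (simp add: F'_def case_prod_beta Sigma_mono cong: if_cong)
  qed auto
  have "\<exists>c. \<forall>t\<in>?T. integral ?Q (P t) = c"
  proof (rule has_derivative_zero_constant)
    show "((\<lambda>t. integral ?Q (P t)) has_derivative (\<lambda>h. 0)) (at t within ?T)" if "t \<in> ?T" for t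
      using D[OF that] I0[OF that] by (simp add: has_field_derivative_def lambda_zero)
  qed auto
  then have "integral ?Q (P 1) = integral ?Q (P 0)"
    by (metis atLeastAtMost_iff order_refl zero_le_one)
  moreover have "integral ?Q (P t) = deg_integral r (\<lambda>x. g x + t *\<^sub>R h x) A z" for t
  proof -
    have "integral ?Q (P t) = integral (A \<inter> ?Q) (\<lambda>x. bump r (G t x) * det (J t x))"
      unfolding P_def by (rule integral_restrict_Int)
    moreover have "A \<inter> ?Q = A" using a by blast
    ultimately show ?thesis
      by (simp add: deg_integral_def jacobian_eq_det_jac jac_affine[OF g h] G_def J_def)
  qed
  from this[of 0] this[of 1] calculation show ?thesis by simp
qed

subsection \<open>The degree integral at regular values\<close>

lemma continuous_on_jacobian:
  assumes "C_order 2 g"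
  shows "continuous_on UNIV (jacobian g)"
  unfolding jacobian_eq_det_jac[abs_def] by (intro continuous_on_det C_order_2_continuous_jac assms)

text \<open>Continuity of the derivative and its invertibility at \<open>x0\<close> give injectivity
  on a ball, and invariance of domain makes the image open. The ball is taken inside
  \<open>S\<close>, where the Jacobian keeps the sign it has at \<open>x0\<close>.\<close>

lemma regular_point_locally_injective:
  fixes g :: "real^'n \<Rightarrow> real^'n"
  assumes g: "C_order 2 g" and x0: "jacobian g x0 \<noteq> 0" and V: "open V" "x0 \<in> V"
  obtains U where "open U" "x0 \<in> U" "U \<subseteq> V" "inj_on g U" "open (g ` U)"
    "\<And>x. x \<in> U \<Longrightarrow> sgn (jacobian g x) = sgn (jacobian g x0)"
proof -
  define S where "S = V \<inter> {x. 0 < jacobian g x * jacobian g x0}"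
  have S: "open S"
    unfolding S_def by (intro open_Int V open_Collect_less continuous_intros continuous_on_jacobian g)
  have x0S: "x0 \<in> S"
    using x0 V by (simp add: S_def zero_less_mult_iff) (meson linorder_neqE_linordered_idom)
  obtain B where B: "B ** jac g x0 = mat 1"
    using x0 invertible_det_nz[of "jac g x0"] by (auto simp: jacobian_eq_det_jac invertible_def)
  have smallonorm: "\<exists>d>0. \<forall>x. dist x0 x < d \<longrightarrow> onorm (\<lambda>v. jac g x *v v - jac g x0 *v v) < e" if "e > 0" for e
  proof -
    \<comment> \<open>\<open>\<psi>\<close> sums the distances of the matrix entries. It dominates
      the operator norm and is continuous, so entrywise continuity of \<open>jac g\<close> becomes
      continuity in operator norm.\<close>
    define \<psi> where "\<psi> x = (\<Sum>i\<in>UNIV. \<Sum>j\<in>UNIV. \<bar>jac g x $ i $ j - jac g x0 $ i $ j\<bar>)" for x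
    have "continuous_on UNIV \<psi>"
      unfolding \<psi>_def by (intro continuous_intros C_order_2_continuous_jac g)
    then obtain d where d: "d > 0" "\<And>x. dist x x0 < d \<Longrightarrow> dist (\<psi> x) (\<psi> x0) < e"
      using \<open>e > 0\<close> by (simp add: continuous_on_iff) blast
    have "onorm (\<lambda>v. jac g x *v v - jac g x0 *v v) < e" if "dist x0 x < d" for x
    proof -
      have "onorm (\<lambda>v. jac g x *v v - jac g x0 *v v) = onorm ((*v) (jac g x - jac g x0))"
        by (simp only: matrix_vector_mult_diff_rdistrib[symmetric])
      also have "\<dots> \<le> \<psi> x"
        using onorm_le_matrix_component_sum[of "jac g x - jac g x0"] by (simp add: \<psi>_def)
      also have "\<dots> < e"
        using d(2)[of x] that by (simp add: dist_commute \<psi>_def)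
      finally show ?thesis .
    qed
    then show ?thesis using d(1) by blast
  qed
  obtain r where r: "r > 0" "ball x0 r \<subseteq> S" "inj_on g (ball x0 r)"
  proof (rule has_derivative_locally_injective[OF x0S S, where f = g and f' = "\<lambda>x v. jac g x *v v" and g' = "(*v) B"])
    show "bounded_linear ((*v) B)" by simp
    show "(*v) B \<circ> (*v) (jac g x0) = id"
      by (simp add: fun_eq_iff matrix_vector_mul_assoc B)
    show "(g has_derivative (*v) (jac g x)) (at x)" for x
      by (rule C_order_2_has_derivative[OF g])
  qed (use smallonorm in auto)
  show thesis
  proof (rule that[of "ball x0 r"])
    show "open (g ` ball x0 r)"
      by (rule invariance_of_domain[OF continuous_on_subset[OF C_order_2_continuous[OF g]]]) (use r in auto)
    show "sgn (jacobian g x) = sgn (jacobian g x0)" if "x \<in> ball x0 r" for x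
      using that r(2) by (auto simp: S_def zero_less_mult_iff)
  qed (use r in \<open>auto simp: S_def\<close>)
qed

definition bump_mass :: "real \<Rightarrow> real^'n \<Rightarrow> real" where
  "bump_mass r z = integral UNIV (\<lambda>v. bump r (v - z))"

lemma bump_integrable:
  fixes z :: "real^'n"
  assumes r: "r > 0" and T: "ball z r \<subseteq> T"
  shows "(\<lambda>v. bump r (v - z)) absolutely_integrable_on T" "integral T (\<lambda>v. bump r (v - z)) = bump_mass r z"
proof -
  obtain a where a: "ball z r \<subseteq> cbox (-a) a"
    using bounded_subset_cbox_symmetric[OF bounded_ball] by blast
  have z: "bump r (v - z) = 0" if "v \<notin> ball z r" for v
    using that r by (intro bump_eq_0) (auto simp: dist_norm norm_minus_commute)
  have restrict: "(\<lambda>v. if v \<in> X then bump r (v - z) else 0) = (\<lambda>v. bump r (v - z))" if "ball z r \<subseteq> X" for X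
  proof (rule ext)
    fix v
    have "bump r (v - z) = 0" if "v \<notin> X"
      using that \<open>ball z r \<subseteq> X\<close> by (intro z) blast
    then show "(if v \<in> X then bump r (v - z) else 0) = bump r (v - z)" by simp
  qed
  have "(\<lambda>v. bump r (v - z)) absolutely_integrable_on cbox (-a) a"
    by (intro absolutely_integrable_continuous continuous_on_compose2[OF continuous_on_bump[of UNIV]] continuous_intros) auto
  then have "(\<lambda>v. bump r (v - z)) absolutely_integrable_on UNIV"
    using absolutely_integrable_restrict_UNIV[of "cbox (-a) a" "\<lambda>v. bump r (v - z)"] by (simp only: restrict[OF a])
  then show "(\<lambda>v. bump r (v - z)) absolutely_integrable_on T"
    using absolutely_integrable_restrict_UNIV[of T "\<lambda>v. bump r (v - z)"] by (simp only: restrict[OF T])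
  show "integral T (\<lambda>v. bump r (v - z)) = bump_mass r z"
    using integral_restrict_UNIV[of T "\<lambda>v. bump r (v - z)"] by (simp only: restrict[OF T] bump_mass_def)
qed

text \<open>A continuous nonnegative function with integral zero over the box would vanish at
  \<open>z\<close>, where the kernel is positive. Positivity allows the mass to be cancelled when
  two degree integrals are compared.\<close>

lemma bump_mass_pos:
  assumes r: "r > 0"
  shows "bump_mass r z > 0"
proof -
  obtain a where a: "ball z r \<subseteq> cbox (-a) a"
    using bounded_subset_cbox_symmetric[OF bounded_ball] by blast
  have z: "z \<in> cbox (-a) a" and i: "z \<in> interior (cbox (-a) a)"
    using a r interior_maximal[OF a] by auto
  have int: "((\<lambda>v. bump r (v - z)) has_integral bump_mass r z) (cbox (-a) a)"
    using bump_integrable[OF r a] unfolding has_integral_iff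
    by (blast intro: set_lebesgue_integral_eq_integral(1))
  have "bump_mass r z \<ge> 0"
    using has_integral_nonneg[OF int] by (simp add: bump_nonneg)
  moreover have "bump_mass r z \<noteq> 0"
  proof
    assume "bump_mass r z = 0"
    have "bump r (z - z) = 0"
    proof (rule has_integral_0_cbox_imp_0[where f = "\<lambda>v. bump r (v - z)", OF _ _ _ _ z])
      show "continuous_on (cbox (-a) a) (\<lambda>v. bump r (v - z))"
        by (intro continuous_on_compose2[OF continuous_on_bump[of UNIV]] continuous_intros) auto
    qed (use i int \<open>bump_mass r z = 0\<close> in \<open>auto simp: bump_nonneg interior_cbox\<close>)
    then show False using bump_pos[of "z - z" r] r by simp
  qed
  ultimately show ?thesis by simp
qed

lemma bump_change_of_variables:
  fixes g :: "real^'n::{finite,wellorder} \<Rightarrow> real^'n::_"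
  assumes g: "C_order 2 g" and U: "open U" "inj_on g U" and r: "r > 0" "ball z r \<subseteq> g ` U"
    and s: "\<And>x. x \<in> U \<Longrightarrow> sgn (jacobian g x) = s"
  shows "((\<lambda>x. bump r (g x - z) * jacobian g x) has_integral s * bump_mass r z) U"
proof -
  \<comment> \<open>The change of variables formula is stated for vector-valued integrands, so the
    kernel is viewed as a map into \<open>real^1\<close>.\<close>
  let ?f = "\<lambda>v. vec (bump r (v - z)) :: real^1"
  have f: "?f absolutely_integrable_on g ` U \<and> integral (g ` U) ?f = vec (bump_mass r z)"
    using bump_integrable[OF r]
    by (simp add: absolutely_integrable_on_1_iff integral_on_1_eq)
  have "(\<lambda>x. \<bar>det (matrix ((*v) (jac g x)))\<bar> *\<^sub>R ?f (g x)) absolutely_integrable_on U \<and>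
     integral U (\<lambda>x. \<bar>det (matrix ((*v) (jac g x)))\<bar> *\<^sub>R ?f (g x)) = vec (bump_mass r z)"
    by (subst has_absolute_integral_change_of_variables[OF _ has_derivative_at_withinI[OF C_order_2_has_derivative[OF g]] U(2)])
      (use f U(1) in auto)
  then have "(\<lambda>x. \<bar>jacobian g x\<bar> * bump r (g x - z)) absolutely_integrable_on U \<and>
     integral U (\<lambda>x. \<bar>jacobian g x\<bar> * bump r (g x - z)) = bump_mass r z"
    by (simp add: absolutely_integrable_on_1_iff integral_on_1_eq jacobian_eq_det_jac vec_eq_iff)
  then have "((\<lambda>x. \<bar>jacobian g x\<bar> * bump r (g x - z)) has_integral bump_mass r z) U"
    unfolding has_integral_iff by (blast intro: set_lebesgue_integral_eq_integral(1))
  \<comment> \<open>\<open>s\<close> is the sign of the Jacobian on all of \<open>U\<close>, so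
    multiplying its absolute value by \<open>s\<close> restores the Jacobian.\<close>
  then have "((\<lambda>x. s * (\<bar>jacobian g x\<bar> * bump r (g x - z))) has_integral s * bump_mass r z) U"
    by (rule has_integral_mult_right)
  then show ?thesis
  proof (rule has_integral_eq[rotated])
    show "s * (\<bar>jacobian g x\<bar> * bump r (g x - z)) = bump r (g x - z) * jacobian g x" if "x \<in> U" for x
      using s[OF that] sgn_mult_abs[of "jacobian g x"] by (metis mult.assoc mult.commute)
  qed
qed

text \<open>This is the sum in the definition of \<open>brouwer_deg\<close>. Over an infinite fibre
  it is 0 by the convention for sums, so finiteness of the fibre has to be known before counts are
  split.\<close>

definition signed_count :: "(real^'n \<Rightarrow> real^'n) \<Rightarrow> (real^'n) set \<Rightarrow> real^'n \<Rightarrow> real" where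
  "signed_count g A z = (\<Sum>x\<in>{x\<in>A. g x = z}. sgn (jacobian g x))"

text \<open>Since \<open>z\<close> is not taken on the frontier, the fibre in \<open>A\<close>
  equals the fibre in \<open>closure A\<close> and is compact. Local injectivity at regular points
  makes it discrete, and a compact discrete set is finite.\<close>

lemma finite_regular_fibre:
  fixes g :: "real^'n \<Rightarrow> real^'n"
  assumes g: "C_order 2 g" and A: "open A" "bounded A"
    and reg: "regular_value_on g A z" and fr: "z \<notin> g ` frontier A"
  shows "finite {x\<in>A. g x = z}"
proof -
  have eq: "{x\<in>A. g x = z} = closure A \<inter> g -` {z}"
    using fr closure_subset[of A] A(1) by (auto simp: frontier_def interior_open)
  define S where "S = {x\<in>A. g x = z}"
  have "closed (g -` {z})"
    by (rule closed_vimage[OF _ C_order_2_continuous[OF g]]) simp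
  then have comp: "compact S"
    unfolding S_def eq using A(2) by (intro compact_Int_closed) (auto simp: compact_closure)
  have "\<forall>x\<in>S. \<exists>U. open U \<and> x \<in> U \<and> U \<inter> S \<subseteq> {x}"
  proof
    fix x assume x: "x \<in> S"
    have "jacobian g x \<noteq> 0" "x \<in> A" using x reg by (auto simp: regular_value_on_def S_def)
    then obtain U where U: "open U" "x \<in> U" "inj_on g U"
      by (rule regular_point_locally_injective[OF g _ A(1)])
    moreover have "U \<inter> S \<subseteq> {x}"
    proof
      fix w assume w: "w \<in> U \<inter> S"
      then have "g w = g x" using x by (simp add: S_def)
      then have "w = x" using inj_onD[OF U(3)] w U(2) by blast
      then show "w \<in> {x}" by simp
    qed
    ultimately show "\<exists>U. open U \<and> x \<in> U \<and> U \<inter> S \<subseteq> {x}" by (intro exI conjI)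
  qed
  from bchoice[OF this] obtain U where U: "\<forall>x\<in>S. open (U x) \<and> x \<in> U x \<and> U x \<inter> S \<subseteq> {x}" ..
  obtain D where D: "D \<subseteq> S" "finite D" "S \<subseteq> (\<Union>x\<in>D. U x)"
    by (rule compactE_image[OF comp, of S U]) (use U in auto)
  have "S \<subseteq> D"
  proof
    fix x assume x: "x \<in> S"
    then obtain w where w: "w \<in> D" "x \<in> U w" using D(3) by blast
    then have "x \<in> {w}" using U D(1) x by blast
    then show "x \<in> D" using w by simp
  qed
  then show ?thesis using finite_subset[OF _ D(2)] by (simp add: S_def)
qed

text \<open>Disjoint neighbourhoods of the fibre points are mapped injectively onto neighbourhoods
  of \<open>z\<close>. Once \<open>r\<close> is small, the kernel is supported in all these images,
  and each neighbourhood contributes its sign times the mass.\<close>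

lemma deg_integral_eq_signed_count:
  fixes g :: "real^'n::{finite,wellorder} \<Rightarrow> real^'n::_"
  assumes g: "C_order 2 g" and A: "open A" "bounded A"
    and reg: "regular_value_on g A z" and fr: "z \<notin> g ` frontier A"
  obtains r0 where "r0 > 0" "\<And>r. 0 < r \<Longrightarrow> r < r0 \<Longrightarrow> deg_integral r g A z = signed_count g A z * bump_mass r z"
proof -
  define S where "S = {x\<in>A. g x = z}"
  have fin: "finite S"
    unfolding S_def by (rule finite_regular_fibre[OF assms])
  \<comment> \<open>\<open>\<rho>\<close> bounds the distances between distinct fibre points from
    below, so balls of radius \<open>\<rho>/2\<close> around them are disjoint. For an empty fibre
    any positive value serves.\<close>
  obtain \<rho> where \<rho>: "\<rho> > 0" "\<And>x y. x \<in> S \<Longrightarrow> y \<in> S \<Longrightarrow> x \<noteq> y \<Longrightarrow> \<rho> \<le> dist x y"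
  proof (cases "S = {}")
    case True
    show thesis by (rule that[of 1]) (use True in auto)
  next
    case False
    have "\<exists>d>0. \<forall>y\<in>S. y \<noteq> x \<longrightarrow> d \<le> dist x y" for x
      using finite_set_avoid[OF fin] by blast
    then obtain d where d: "\<And>x. d x > 0" "\<And>x y. y \<in> S \<Longrightarrow> y \<noteq> x \<Longrightarrow> d x \<le> dist x y" by metis
    show thesis
    proof (rule that[of "Min (d ` S)"])
      show "0 < Min (d ` S)" using fin False d(1) by simp
      show "Min (d ` S) \<le> dist x y" if "x \<in> S" "y \<in> S" "x \<noteq> y" for x y
      proof -
        have "Min (d ` S) \<le> d x" using fin that by (intro Min_le) auto
        also have "d x \<le> dist x y" using d(2)[of y x] that by auto
        finally show ?thesis .
      qed
    qed
  qed
  define \<sigma> where "\<sigma> x = sgn (jacobian g x)" for x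
  have "\<exists>U. open U \<and> x \<in> U \<and> U \<subseteq> A \<inter> ball x (\<rho>/2) \<and> inj_on g U \<and> open (g ` U) \<and>
      (\<forall>y\<in>U. sgn (jacobian g y) = \<sigma> x)" if "x \<in> S" for x
  proof -
    have "jacobian g x \<noteq> 0" using that reg by (auto simp: regular_value_on_def S_def)
    moreover have "open (A \<inter> ball x (\<rho>/2))" "x \<in> A \<inter> ball x (\<rho>/2)"
      using that \<rho>(1) A(1) by (auto simp: S_def)
    ultimately show ?thesis
    proof (rule regular_point_locally_injective[OF g, folded \<sigma>_def])
      fix U assume "open U" "x \<in> U" "U \<subseteq> A \<inter> ball x (\<rho>/2)" "inj_on g U" "open (g ` U)"
        "\<And>y. y \<in> U \<Longrightarrow> \<sigma> y = \<sigma> x"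
      then show ?thesis unfolding \<sigma>_def by (intro exI[of _ U] conjI ballI)
    qed
  qed
  then have "\<forall>x\<in>S. \<exists>U. open U \<and> x \<in> U \<and> U \<subseteq> A \<inter> ball x (\<rho>/2) \<and> inj_on g U \<and> open (g ` U) \<and>
      (\<forall>y\<in>U. sgn (jacobian g y) = \<sigma> x)" by (rule ballI)
  from bchoice[OF this] obtain U where U0: "\<forall>x\<in>S. open (U x) \<and> x \<in> U x \<and> U x \<subseteq> A \<inter> ball x (\<rho>/2) \<and>
      inj_on g (U x) \<and> open (g ` U x) \<and> (\<forall>y\<in>U x. sgn (jacobian g y) = \<sigma> x)" ..
  have U: "\<And>x. x \<in> S \<Longrightarrow> open (U x)" "\<And>x. x \<in> S \<Longrightarrow> x \<in> U x"
    "\<And>x. x \<in> S \<Longrightarrow> U x \<subseteq> A \<inter> ball x (\<rho>/2)" "\<And>x. x \<in> S \<Longrightarrow> inj_on g (U x)"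
    "\<And>x. x \<in> S \<Longrightarrow> open (g ` U x)"
    "\<And>x y. x \<in> S \<Longrightarrow> y \<in> U x \<Longrightarrow> sgn (jacobian g y) = \<sigma> x"
    by (drule bspec[OF U0], simp)+
  have disj: "U x \<inter> U y = {}" if "x \<in> S" "y \<in> S" "x \<noteq> y" for x y
  proof -
    have False if "w \<in> U x" "w \<in> U y" for w
    proof -
      have "dist x w < \<rho>/2" "dist y w < \<rho>/2"
        using that U(3)[OF \<open>x \<in> S\<close>] U(3)[OF \<open>y \<in> S\<close>] by auto
      then have "dist x y < \<rho>" using dist_triangle_half_l[of x w \<rho> y] by simp
      then show False using \<rho>(2)[OF \<open>x \<in> S\<close> \<open>y \<in> S\<close> \<open>x \<noteq> y\<close>] by linarith
    qed
    then show ?thesis by blast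
  qed
  have "\<exists>e>0. \<forall>x\<in>S. ball z e \<subseteq> g ` U x"
  proof -
    have "open (\<Inter>x\<in>S. g ` U x)" using fin U(5) by auto
    moreover have "z \<in> (\<Inter>x\<in>S. g ` U x)"
    proof
      fix x assume x: "x \<in> S"
      then have "g x = z" by (simp add: S_def)
      then show "z \<in> g ` U x" using imageI[OF U(2)[OF x], of g] by simp
    qed
    ultimately obtain e where "e > 0" "ball z e \<subseteq> (\<Inter>x\<in>S. g ` U x)"
      by (rule openE)
    then show ?thesis by blast
  qed
  then obtain e where e: "e > 0" "\<And>x. x \<in> S \<Longrightarrow> ball z e \<subseteq> g ` U x" by blast
  \<comment> \<open>\<open>K\<close> is the part of \<open>closure A\<close> outside the
    neighbourhoods. Its image is compact and misses \<open>z\<close>, which gives a second bound on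
    \<open>r\<close>: below it the integrand vanishes off the neighbourhoods.\<close>
  define K where "K = closure A - (\<Union>x\<in>S. U x)"
  have "compact K"
    unfolding K_def using A(2) U(1) by (intro compact_diff open_UN) (auto simp: compact_closure)
  then have "compact (g ` K)"
    by (intro compact_continuous_image continuous_on_subset[OF C_order_2_continuous[OF g]]) auto
  then have "open (- g ` K)"
    using compact_imp_closed by blast
  moreover have "z \<in> - g ` K"
  proof (rule ComplI)
    assume "z \<in> g ` K"
    then obtain x where x: "x \<in> K" "g x = z" by blast
    show False
    proof (cases "x \<in> A")
      case True
      then have "x \<in> S" using x(2) by (simp add: S_def)
      then show False using U(2)[of x] x(1) by (auto simp: K_def)
    next
      case False
      then have "x \<in> frontier A" using x(1) A(1) by (simp add: K_def frontier_def interior_open)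
      then show False using fr x(2) by blast
    qed
  qed
  ultimately obtain e' where e': "e' > 0" "ball z e' \<subseteq> - g ` K"
    by (rule openE)
  show thesis
  proof (rule that[of "min e e'"])
    show "min e e' > 0" using e e' by simp
  next
    fix r assume r: "0 < r" "r < min e e'"
    let ?f = "\<lambda>x. bump r (g x - z) * jacobian g x"
    have "(?f has_integral (\<Sum>x\<in>S. \<sigma> x * bump_mass r z)) (\<Union>x\<in>S. U x)"
    proof (rule has_integral_UN[OF fin])
      fix x assume x: "x \<in> S"
      have "ball z r \<subseteq> ball z e" using r by auto
      then have "ball z r \<subseteq> g ` U x" using e(2)[OF x] by (rule subset_trans)
      then show "(?f has_integral \<sigma> x * bump_mass r z) (U x)"
        by (intro bump_change_of_variables[OF g U(1)[OF x] U(4)[OF x] r(1)] U(6)[OF x])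
    next
      show "pairwise (\<lambda>x y. negligible (U x \<inter> U y)) S"
        by (rule pairwiseI) (simp add: disj)
    qed
    moreover have "{x \<in> (\<Union>x\<in>S. U x) - A. ?f x \<noteq> 0} = {}" using U(3) by blast
    then have "negligible {x \<in> (\<Union>x\<in>S. U x) - A. ?f x \<noteq> 0}" by (simp only: negligible_empty)
    moreover have "?f x = 0" if "x \<in> A - (\<Union>x\<in>S. U x)" for x
    proof -
      have "x \<in> K" using that closure_subset[of A] by (auto simp: K_def)
      then have "g x \<notin> ball z e'" using e'(2) by blast
      then have "bump r (g x - z) = 0" using r by (intro bump_eq_0) (auto simp: dist_norm norm_minus_commute)
      then show ?thesis by simp
    qed
    then have "{x \<in> A - (\<Union>x\<in>S. U x). ?f x \<noteq> 0} = {}" by blast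
    then have "negligible {x \<in> A - (\<Union>x\<in>S. U x). ?f x \<noteq> 0}" by (simp only: negligible_empty)
    ultimately have "(?f has_integral (\<Sum>x\<in>S. \<sigma> x * bump_mass r z)) A"
      using has_integral_spike_set_eq[of "\<Union>x\<in>S. U x" A ?f] by simp
    then have "integral A ?f = (\<Sum>x\<in>S. \<sigma> x * bump_mass r z)"
      by (rule integral_unique)
    then show "deg_integral r g A z = signed_count g A z * bump_mass r z"
      by (simp add: deg_integral_def signed_count_def S_def sum_distrib_right \<sigma>_def)
  qed
qed

subsection \<open>Homotopy invariance of the signed count\<close>

text \<open>The bound is phrased as the existence of some \<open>r\<close> and not through an
  infimum, so it also covers empty \<open>K\<close>, in particular the frontier of the empty
  set.\<close>

lemma uniform_distance_from_value:
  fixes F :: "'a::metric_space \<Rightarrow> 'b::metric_space"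
  assumes "compact K" "continuous_on K F" "z \<notin> F ` K"
  obtains r where "r > 0" "\<And>p. p \<in> K \<Longrightarrow> r \<le> dist (F p) z"
proof -
  have "compact (F ` K)"
    using assms compact_continuous_image by blast
  then have "open (- F ` K)"
    using compact_imp_closed by blast
  moreover have "z \<in> - F ` K" using assms by blast
  ultimately obtain r where r: "r > 0" "ball z r \<subseteq> - F ` K"
    by (rule openE)
  have "r \<le> dist (F p) z" if "p \<in> K" for p
  proof (rule ccontr)
    assume "\<not> r \<le> dist (F p) z"
    then have "F p \<in> ball z r" by (simp add: dist_commute)
    then show False using r(2) that by blast
  qed
  then show thesis using that r(1) by blast
qed

lemma signed_count_homotopy_wellorder:
  fixes g h :: "real^'n::{finite,wellorder} \<Rightarrow> real^'n::_"
  assumes A: "open A" "bounded A" and g: "C_order 2 g" and h: "C_order 2 h"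
    and rg: "regular_value_on g A z" and rh: "regular_value_on (\<lambda>x. g x + h x) A z"
    and fr: "\<And>t x. t \<in> {0..1} \<Longrightarrow> x \<in> frontier A \<Longrightarrow> g x + t *\<^sub>R h x \<noteq> z"
  shows "signed_count (\<lambda>x. g x + h x) A z = signed_count g A z"
proof -
  have gh: "C_order 2 (\<lambda>x. g x + h x)"
    using C_order_affine[OF g h, of 1] by simp
  \<comment> \<open>The homotopy on the frontier is treated as one map on a compact product, so that
    a single distance to \<open>z\<close> works for every \<open>t\<close>.\<close>
  have cF: "continuous_on ({0..1} \<times> frontier A) (\<lambda>p. g (snd p) + fst p *\<^sub>R h (snd p))"
    by (intro continuous_intros continuous_on_compose2[OF C_order_2_continuous[OF g]]
        continuous_on_compose2[OF C_order_2_continuous[OF h]]) auto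
  have comp: "compact ({0..1::real} \<times> frontier A)"
    using A(2) by (intro compact_Times compact_frontier_bounded) auto
  have "z \<notin> (\<lambda>p. g (snd p) + fst p *\<^sub>R h (snd p)) ` ({0..1} \<times> frontier A)"
    using fr by force
  then obtain r1 where r1: "r1 > 0"
    "\<And>p. p \<in> {0..1} \<times> frontier A \<Longrightarrow> r1 \<le> dist (g (snd p) + fst p *\<^sub>R h (snd p)) z"
    using uniform_distance_from_value[OF comp cF] by blast
  have "z \<notin> g ` frontier A" using fr[of 0] by auto
  then obtain r2 where r2: "r2 > 0"
    "\<And>r. 0 < r \<Longrightarrow> r < r2 \<Longrightarrow> deg_integral r g A z = signed_count g A z * bump_mass r z"
    using deg_integral_eq_signed_count[OF g A rg] by blast
  have "z \<notin> (\<lambda>x. g x + h x) ` frontier A" using fr[of 1] by auto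
  then obtain r3 where r3: "r3 > 0" "\<And>r. 0 < r \<Longrightarrow> r < r3 \<Longrightarrow>
      deg_integral r (\<lambda>x. g x + h x) A z = signed_count (\<lambda>x. g x + h x) A z * bump_mass r z"
    using deg_integral_eq_signed_count[OF gh A rh] by blast
  \<comment> \<open>Below \<open>r1\<close> the homotopy argument applies; below \<open>r2\<close>
    and \<open>r3\<close> the two endpoint integrals are signed counts times the same mass. Halving
    makes the inequalities strict.\<close>
  define r where "r = min r1 (min r2 r3) / 2"
  have r: "0 < r" "r < r1" "r < r2" "r < r3"
    using r1(1) r2(1) r3(1) by (auto simp: r_def min_def)
  have "deg_integral r (\<lambda>x. g x + h x) A z = deg_integral r g A z"
  proof (rule deg_integral_homotopy[OF A r(1) g h])
    fix t :: real and x assume "t \<in> {0..1}" "x \<in> frontier A"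
    then show "r < norm (g x + t *\<^sub>R h x - z)"
      using r1(2)[of "(t, x)"] r(2) by (simp add: dist_norm)
  qed
  then show ?thesis
    using r2(2)[OF r(1,3)] r3(2)[OF r(1,4)] bump_mass_pos[OF r(1), of z] by simp
qed

subsection \<open>Transport to well-ordered index types\<close>

text \<open>The change of variables formula and Sard's theorem of the library require a well-ordered
  index type, so both are carried over from an ordered copy of the index type.\<close>

typedef 'n ordered_index = "{..<CARD('n::finite)}"
  by (rule exI[of _ 0]) simp

instantiation ordered_index :: (finite) linorder
begin

definition less_eq_ordered_index :: "'a ordered_index \<Rightarrow> 'a ordered_index \<Rightarrow> bool" where
  "i \<le> j \<longleftrightarrow> Rep_ordered_index i \<le> Rep_ordered_index j"

definition less_ordered_index :: "'a ordered_index \<Rightarrow> 'a ordered_index \<Rightarrow> bool" where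
  "i < j \<longleftrightarrow> Rep_ordered_index i < Rep_ordered_index j"

instance
  by standard (auto simp: less_eq_ordered_index_def less_ordered_index_def Rep_ordered_index_inject)

end

instance ordered_index :: (finite) finite
proof
  have "Abs_ordered_index ` {..<CARD('a)} = (UNIV :: 'a ordered_index set)"
    using type_definition.Abs_image[OF type_definition_ordered_index] .
  then show "finite (UNIV :: 'a ordered_index set)"
    by (metis finite_imageI finite_lessThan)
qed

instance ordered_index :: (finite) wellorder
proof
  fix P :: "'a ordered_index \<Rightarrow> bool" and a :: "'a ordered_index"
  assume step: "\<And>i. (\<And>j. j < i \<Longrightarrow> P j) \<Longrightarrow> P i"
  show "P a"
  proof (induction "Rep_ordered_index a" arbitrary: a rule: less_induct)
    case less
    show ?case
      by (rule step, rule less) (simp add: less_ordered_index_def)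
  qed
qed

lemma ex_bij_ordered_index: "\<exists>\<pi> :: 'n::finite ordered_index \<Rightarrow> 'n. bij \<pi>"
proof -
  have "CARD('n ordered_index) = CARD('n)"
    by (simp add: type_definition.card[OF type_definition_ordered_index])
  then show ?thesis
    using finite_same_card_bij[of "UNIV :: 'n ordered_index set" "UNIV :: 'n set"] by auto
qed

definition permute_coords :: "('m \<Rightarrow> 'n) \<Rightarrow> real^'n \<Rightarrow> real^'m" where
  "permute_coords \<pi> x = (\<chi> i. x $ \<pi> i)"

lemma permute_coords_nth [simp]: "permute_coords \<pi> x $ i = x $ \<pi> i"
  by (simp add: permute_coords_def)

lemma bounded_linear_permute_coords: "bounded_linear (permute_coords \<pi> :: real^'n::finite \<Rightarrow> real^'m::finite)"
  by (rule linear_conv_bounded_linear[THEN iffD1], rule linearI) (simp_all add: vec_eq_iff)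

lemma permute_coords_inverse:
  assumes "bij \<pi>"
  shows "permute_coords (inv \<pi>) (permute_coords \<pi> x) = x" "permute_coords \<pi> (permute_coords (inv \<pi>) w) = w"
  using assms by (simp_all add: vec_eq_iff bij_is_surj surj_f_inv_f bij_is_inj inv_f_f)

text \<open>Conjugation by \<open>\<pi>\<close> is a sign-preserving bijection between the
  permutations of the two index types, and it matches the terms of the Leibniz expansions one by
  one.\<close>

lemma det_reindex:
  fixes M :: "real^'n^'n" and \<pi> :: "'m::finite \<Rightarrow> 'n"
  assumes bij: "bij \<pi>"
  shows "det (\<chi> i j. M $ \<pi> i $ \<pi> j) = det M"
proof -
  let ?T = "map_permutation UNIV \<pi>" and ?S = "map_permutation UNIV (inv \<pi>)"
  have inj: "inj \<pi>" "inj (inv \<pi>)" and surj: "range \<pi> = UNIV" "range (inv \<pi>) = UNIV"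
    using bij bij_imp_bij_inv[OF bij] by (auto simp: bij_def)
  have T: "?T p = (\<lambda>k. \<pi> (p (inv \<pi> k)))" for p
    using surj by (simp add: map_permutation_def fun_eq_iff)
  have S: "?S q = (\<lambda>i. inv \<pi> (q (\<pi> i)))" for q
    using surj bij by (simp add: map_permutation_def fun_eq_iff inv_inv_eq)
  have pT: "?T p permutes UNIV" if "p permutes UNIV" for p
    by (rule map_permutation_permutes[OF bij that])
  have pS: "?S q permutes UNIV" if "q permutes UNIV" for q
    by (rule map_permutation_permutes[OF bij_imp_bij_inv[OF bij] that])
  show ?thesis
    unfolding det_def
  proof (rule sum.reindex_bij_witness[where j = ?T and i = ?S])
    fix p :: "'m \<Rightarrow> 'm" assume p: "p \<in> {p. p permutes UNIV}"
    show "?S (?T p) = p"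
      unfolding S T using bij by (simp add: bij_is_inj inv_f_f)
    show "?T p \<in> {p. p permutes UNIV}" using p pT by blast
    have "(\<Prod>k\<in>UNIV. M $ k $ ?T p k) = (\<Prod>i\<in>UNIV. M $ \<pi> i $ ?T p (\<pi> i))"
      by (rule prod.reindex_bij_betw[OF bij, symmetric])
    moreover have "?T p (\<pi> i) = \<pi> (p i)" for i
      unfolding T using bij by (simp add: bij_is_inj inv_f_f)
    ultimately show "of_int (sign (?T p)) * (\<Prod>k\<in>UNIV. M $ k $ ?T p k) =
        of_int (sign p) * (\<Prod>i\<in>UNIV. (\<chi> i j. M $ \<pi> i $ \<pi> j) $ i $ p i)"
      using sign_map_permutation[of \<pi> UNIV p] p inj by simp
  next
    fix q :: "'n \<Rightarrow> 'n" assume q: "q \<in> {q. q permutes UNIV}"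
    show "?T (?S q) = q"
      unfolding S T using bij by (simp add: bij_is_surj surj_f_inv_f)
    show "?S q \<in> {p. p permutes UNIV}" using q pS by blast
  qed
qed

lemma C_order_compose_linear:
  assumes "bounded_linear T" "bounded_linear S" "C_order k g"
  shows "C_order k (\<lambda>x. T (g (S x)))"
  using assms(3)
proof (induction k arbitrary: g)
  case 0
  then have "continuous_on UNIV g" by simp
  then have "continuous_on UNIV (\<lambda>x. g (S x))"
    by (rule continuous_on_compose2[OF _ linear_continuous_on[OF assms(2)]]) simp
  then have "continuous_on UNIV (\<lambda>x. T (g (S x)))"
    by (rule continuous_on_compose2[OF linear_continuous_on[OF assms(1), of UNIV]]) simp
  then show ?case by simp
next
  case (Suc k)
  obtain g' where g': "\<And>x. (g has_derivative g' x) (at x)" "\<And>h. C_order k (\<lambda>x. g' x h)"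
    using Suc.prems unfolding C_order.simps by blast
  have "((\<lambda>x. T (g (S x))) has_derivative (\<lambda>h. T (g' (S x) (S h)))) (at x)" for x
    by (rule bounded_linear.has_derivative[OF assms(1)
        has_derivative_compose[OF bounded_linear_imp_has_derivative[OF assms(2)] g'(1)]])
  moreover have "C_order k (\<lambda>x. T (g' (S x) (S h)))" for h
    by (rule Suc.IH[OF g'(2)])
  ultimately show ?case
    unfolding C_order.simps by (intro exI[of _ "\<lambda>x h. T (g' (S x) (S h))"] conjI allI)
qed

context
  fixes \<pi> :: "'m::finite \<Rightarrow> 'n::finite"
  assumes bij: "bij \<pi>"
begin

abbreviation (input) conj_coords :: "(real^'n \<Rightarrow> real^'n) \<Rightarrow> real^'m \<Rightarrow> real^'m" where
  "conj_coords g w \<equiv> permute_coords \<pi> (g (permute_coords (inv \<pi>) w))"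

lemma C_order_conj_coords: "C_order k g \<Longrightarrow> C_order k (conj_coords g)"
  by (rule C_order_compose_linear[OF bounded_linear_permute_coords bounded_linear_permute_coords])

text \<open>The same bijection relabels rows and columns, so the determinant keeps its value, sign
  included, whichever \<open>\<pi>\<close> is chosen.\<close>

lemma jacobian_conj_coords:
  assumes g: "C_order 2 g"
  shows "jacobian (conj_coords g) w = jacobian g (permute_coords (inv \<pi>) w)"
proof -
  let ?x = "permute_coords (inv \<pi>) w"
  have "(conj_coords g has_derivative (\<lambda>v. permute_coords \<pi> (jac g ?x *v permute_coords (inv \<pi>) v))) (at w)"
    by (rule bounded_linear.has_derivative[OF bounded_linear_permute_coords
        has_derivative_compose[OF bounded_linear_imp_has_derivative[OF bounded_linear_permute_coords]
          C_order_2_has_derivative[OF g]]])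
  then have "jac (conj_coords g) w = matrix (\<lambda>v. permute_coords \<pi> (jac g ?x *v permute_coords (inv \<pi>) v))"
    by (rule has_derivative_jac)
  also have "\<dots> = (\<chi> i j. jac g ?x $ \<pi> i $ \<pi> j)"
  proof -
    have "inv \<pi> k = j \<longleftrightarrow> k = \<pi> j" for k j
      using bij_inv_eq_iff[OF bij, of j k] by auto
    then have "permute_coords (inv \<pi>) (axis j 1) = axis (\<pi> j) 1" for j
      by (simp add: vec_eq_iff axis_def)
    then show ?thesis
      by (simp add: matrix_def matrix_vector_mult_basis column_def)
  qed
  finally show ?thesis
    by (simp add: jacobian_eq_det_jac det_reindex[OF bij])
qed

lemma inj_permute_coords: "inj (permute_coords \<pi> :: real^'n \<Rightarrow> real^'m)"
  using permute_coords_inverse(1)[OF bij] by (rule inj_on_inverseI)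

lemma signed_count_conj_coords:
  assumes g: "C_order 2 g"
  shows "signed_count (conj_coords g) (permute_coords \<pi> ` A) (permute_coords \<pi> z) = signed_count g A z"
proof -
  have "{w \<in> permute_coords \<pi> ` A. conj_coords g w = permute_coords \<pi> z}
      = permute_coords \<pi> ` {x\<in>A. g x = z}"
    using inj_permute_coords by (auto simp: permute_coords_inverse[OF bij] dest: injD)
  moreover have "inj_on (permute_coords \<pi> :: real^'n \<Rightarrow> real^'m) {x\<in>A. g x = z}"
    using inj_permute_coords inj_on_subset by blast
  ultimately show ?thesis
    unfolding signed_count_def
    by (simp add: sum.reindex jacobian_conj_coords[OF g] permute_coords_inverse[OF bij])
qed

lemma regular_value_on_conj_coords:
  assumes g: "C_order 2 g" and "regular_value_on g A z"
  shows "regular_value_on (conj_coords g) (permute_coords \<pi> ` A) (permute_coords \<pi> z)"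
  using assms(2) inj_permute_coords
  by (auto simp: regular_value_on_def jacobian_conj_coords[OF g] permute_coords_inverse[OF bij] dest: injD)

lemma open_permute_coords:
  assumes "open A"
  shows "open ((permute_coords \<pi> :: real^'n \<Rightarrow> real^'m) ` A)"
proof -
  have "(permute_coords \<pi> :: real^'n \<Rightarrow> real^'m) ` A = permute_coords (inv \<pi>) -` A"
    using permute_coords_inverse[OF bij] by (auto simp: image_iff) metis
  then show ?thesis
    using open_vimage[OF assms linear_continuous_on[OF bounded_linear_permute_coords]] by simp
qed

lemma frontier_permute_coords:
  assumes "open A"
  shows "frontier ((permute_coords \<pi> :: real^'n \<Rightarrow> real^'m) ` A) = permute_coords \<pi> ` frontier A"
proof -
  have "closure ((permute_coords \<pi> :: real^'n \<Rightarrow> real^'m) ` A) = permute_coords \<pi> ` closure A"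
    by (rule closure_injective_linear_image[symmetric])
      (simp_all add: bounded_linear.linear[OF bounded_linear_permute_coords] inj_permute_coords)
  then show ?thesis
    using assms open_permute_coords[OF assms]
    by (simp add: frontier_def interior_open image_set_diff[OF inj_permute_coords])
qed

end

lemma signed_count_homotopy:
  fixes g h :: "real^'n \<Rightarrow> real^'n"
  assumes A: "open A" "bounded A" and g: "C_order 2 g" and h: "C_order 2 h"
    and rg: "regular_value_on g A z" and rh: "regular_value_on (\<lambda>x. g x + h x) A z"
    and fr: "\<And>t x. t \<in> {0..1} \<Longrightarrow> x \<in> frontier A \<Longrightarrow> g x + t *\<^sub>R h x \<noteq> z"
  shows "signed_count (\<lambda>x. g x + h x) A z = signed_count g A z"
proof -
  obtain \<pi> :: "'n ordered_index \<Rightarrow> 'n" where bij: "bij \<pi>"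
    using ex_bij_ordered_index by blast
  interpret T: bounded_linear "permute_coords \<pi> :: real^'n \<Rightarrow> _"
    by (rule bounded_linear_permute_coords)
  let ?T = "permute_coords \<pi>" and ?S = "permute_coords (inv \<pi>)"
  have gh: "C_order 2 (\<lambda>x. g x + h x)"
    using C_order_affine[OF g h, of 1] by simp
  have "signed_count (\<lambda>w. ?T (g (?S w)) + ?T (h (?S w))) (?T ` A) (?T z)
      = signed_count (\<lambda>w. ?T (g (?S w))) (?T ` A) (?T z)"
  proof (rule signed_count_homotopy_wellorder)
    show "open (?T ` A)" by (rule open_permute_coords[OF bij A(1)])
    show "bounded (?T ` A)"
      by (rule bounded_linear_image[OF A(2) bounded_linear_permute_coords])
    show "C_order 2 (\<lambda>w. ?T (g (?S w)))" "C_order 2 (\<lambda>w. ?T (h (?S w)))"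
      using C_order_conj_coords[OF bij] g h by blast+
    show "regular_value_on (\<lambda>w. ?T (g (?S w))) (?T ` A) (?T z)"
      by (rule regular_value_on_conj_coords[OF bij g rg])
    show "regular_value_on (\<lambda>w. ?T (g (?S w)) + ?T (h (?S w))) (?T ` A) (?T z)"
      using regular_value_on_conj_coords[OF bij gh rh] by (simp add: T.add)
    fix t :: real and w assume t: "t \<in> {0..1}" and w: "w \<in> frontier (?T ` A)"
    obtain x where x: "x \<in> frontier A" "w = ?T x"
      using w unfolding frontier_permute_coords[OF bij A(1)] by blast
    have "?T (g x + t *\<^sub>R h x) \<noteq> ?T z"
      using fr[OF t x(1)] inj_permute_coords[OF bij] by (auto dest: injD)
    then show "?T (g (?S w)) + t *\<^sub>R ?T (h (?S w)) \<noteq> ?T z"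
      by (simp add: x(2) permute_coords_inverse[OF bij] T.add T.scaleR)
  qed
  then show ?thesis
    using signed_count_conj_coords[OF bij gh, of A z] signed_count_conj_coords[OF bij g, of A z]
    by (simp add: T.add)
qed

section \<open>Critical values\<close>

lemma critical_values_negligible:
  fixes g :: "real^'n::{finite,wellorder} \<Rightarrow> real^'n::_"
  assumes g: "C_order 2 g"
  shows "negligible (g ` {x. jacobian g x = 0})"
proof (rule baby_Sard)
  show "(g has_derivative (*v) (jac g x)) (at x within {x. jacobian g x = 0})" for x
    by (rule has_derivative_at_withinI[OF C_order_2_has_derivative[OF g]])
  show "rank (matrix ((*v) (jac g x))) < CARD('n)" if "x \<in> {x. jacobian g x = 0}" for x
    using that by (simp add: jacobian_eq_det_jac det_eq_0_rank)
qed simp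

text \<open>Emptiness of the interior is the form of Sard's theorem that passes easily to arbitrary
  index types: a coordinate permutation maps open sets to open sets, and a nonempty open set is not
  negligible.\<close>

lemma interior_critical_values:
  fixes g :: "real^'n \<Rightarrow> real^'n"
  assumes g: "C_order 2 g"
  shows "interior (g ` {x. jacobian g x = 0}) = {}"
proof (rule ccontr)
  assume ne: "interior (g ` {x. jacobian g x = 0}) \<noteq> {}" (is "interior ?C \<noteq> {}")
  obtain \<pi> :: "'n ordered_index \<Rightarrow> 'n" where bij: "bij \<pi>"
    using ex_bij_ordered_index by blast
  let ?T = "permute_coords \<pi>" and ?S = "permute_coords (inv \<pi>)"
  let ?g = "\<lambda>w. ?T (g (?S w))"
  have "?T ` ?C \<subseteq> ?g ` {w. jacobian ?g w = 0}"
  proof clarify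
    fix x assume "jacobian g x = 0"
    then have "jacobian ?g (?T x) = 0"
      by (simp add: jacobian_conj_coords[OF bij g] permute_coords_inverse[OF bij])
    then show "?T (g x) \<in> ?g ` {w. jacobian ?g w = 0}"
      by (intro image_eqI[of _ _ "?T x"]) (simp_all add: permute_coords_inverse[OF bij])
  qed
  then have "negligible (?T ` ?C)"
    using critical_values_negligible[OF C_order_conj_coords[OF bij g]] negligible_subset by blast
  then have "negligible (?T ` interior ?C)"
    using negligible_subset interior_subset image_mono by metis
  then show False
    using open_not_negligible[OF open_permute_coords[OF bij open_interior[of ?C]]] ne by simp
qed

subsection \<open>The Brouwer degree\<close>

lemma C_order_const: "C_order k (\<lambda>x. c)"
proof (induction k arbitrary: c)
  case (Suc k)
  show ?case
    unfolding C_order.simps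
    by (intro exI[of _ "\<lambda>x h. 0"] conjI allI Suc.IH) simp
qed simp

lemma C_order_add: "C_order k f \<Longrightarrow> C_order k g \<Longrightarrow> C_order k (\<lambda>x. f x + g x)"
  using C_order_affine[of k f g 1] by simp

lemma C_order_bounded_linear:
  assumes "bounded_linear f"
  shows "C_order k f"
proof (cases k)
  case 0
  then show ?thesis by (simp add: linear_continuous_on[OF assms])
next
  case (Suc k)
  show ?thesis
    unfolding Suc C_order.simps
    by (intro exI[of _ "\<lambda>x. f"] conjI allI C_order_const bounded_linear_imp_has_derivative assms)
qed

lemma C_order_mult:
  fixes f g :: "'a::euclidean_space \<Rightarrow> real"
  assumes "C_order k f" "C_order k g"
  shows "C_order k (\<lambda>x. f x * g x)"
  using assms
proof (induction k arbitrary: f g)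
  case 0
  then show ?case by (auto intro!: continuous_intros)
next
  case (Suc k)
  obtain f' where f': "\<And>x. (f has_derivative f' x) (at x)" "\<And>h. C_order k (\<lambda>x. f' x h)"
    using Suc.prems(1) unfolding C_order.simps by blast
  obtain g' where g': "\<And>x. (g has_derivative g' x) (at x)" "\<And>h. C_order k (\<lambda>x. g' x h)"
    using Suc.prems(2) unfolding C_order.simps by blast
  have d: "((\<lambda>x. f x * g x) has_derivative (\<lambda>h. f x * g' x h + f' x h * g x)) (at x)" for x
    by (rule has_derivative_mult[OF f'(1) g'(1)])
  have c: "C_order k (\<lambda>x. f x * g' x h + f' x h * g x)" for h
    by (rule C_order_add[OF Suc.IH[OF C_order_SucD[OF Suc.prems(1)] g'(2)]
          Suc.IH[OF f'(2) C_order_SucD[OF Suc.prems(2)]]])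
  show ?case
    unfolding C_order.simps
    by (rule exI[of _ "\<lambda>x h. f x * g' x h + f' x h * g x"], rule conjI)
      (rule allI, rule d, rule allI, rule c)
qed

lemma smooth_polynomial_function:
  fixes p :: "'a::euclidean_space \<Rightarrow> 'b::euclidean_space"
  assumes "polynomial_function p"
  shows "smooth p"
  unfolding smooth_def
proof
  fix k
  have real: "C_order k q" if "real_polynomial_function q" for q :: "'a \<Rightarrow> real"
    using that
    by induction (simp_all add: C_order_bounded_linear C_order_const C_order_add C_order_mult)
  have comp: "C_order k (\<lambda>x. (p x \<bullet> b) *\<^sub>R b)" for b
  proof -
    have "real_polynomial_function (\<lambda>x. p x \<bullet> b)"
      using assms bounded_linear_inner_left[of b] by (auto simp: polynomial_function_def o_def)
    from C_order_compose_linear[OF bounded_linear_scaleR_left bounded_linear_ident real[OF this]]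
    show ?thesis .
  qed
  have "C_order k (\<lambda>x. \<Sum>b\<in>B. (p x \<bullet> b) *\<^sub>R b)" if "finite B" for B
    using that by (induction B) (simp_all add: C_order_const C_order_add comp)
  from this[OF finite_Basis] show "C_order k p"
    by (simp add: euclidean_representation)
qed

lemma smooth_translate: "smooth g \<Longrightarrow> smooth (\<lambda>x. g x + c)"
  by (simp add: smooth_def C_order_add C_order_const)

lemma jacobian_translate:
  fixes g :: "real^'n \<Rightarrow> real^'n"
  assumes "C_order 2 g"
  shows "jacobian (\<lambda>x. g x + c) x = jacobian g x"
proof -
  have "((\<lambda>x. g x + c) has_derivative (\<lambda>v. jac g x *v v + 0)) (at x)"
    by (intro has_derivative_add has_derivative_const C_order_2_has_derivative assms)
  from has_derivative_jac[OF this] show ?thesis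
    by (simp add: jacobian_eq_det_jac)
qed

text \<open>A polynomial from the Stone-Weierstrass theorem uses half of the tolerance. The other
  half is spent on a noncritical value \<open>v\<close> near \<open>z\<close>: adding
  \<open>z - v\<close> moves the fibre over \<open>v\<close> to \<open>z\<close>. Critical points in
  the whole space are taken into account, so one \<open>g\<close> serves every set
  \<open>A\<close>.\<close>

lemma smooth_regular_approximation:
  fixes y :: "real^'n \<Rightarrow> real^'n"
  assumes K: "compact K" "continuous_on K y" and e: "e > 0"
  obtains g where "smooth g" "\<And>A. regular_value_on g A z" "\<And>x. x \<in> K \<Longrightarrow> dist (g x) (y x) < e"
proof -
  obtain p where p: "polynomial_function p" "\<And>x. x \<in> K \<Longrightarrow> norm (y x - p x) < e/2"
    using Stone_Weierstrass_polynomial_function[OF K, of "e/2"] e by auto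
  have sp: "smooth p" by (rule smooth_polynomial_function[OF p(1)])
  have p2: "C_order 2 p" using sp by (rule smooth_C_order)
  have "\<not> ball z (e/2) \<subseteq> p ` {x. jacobian p x = 0}"
  proof
    assume "ball z (e/2) \<subseteq> p ` {x. jacobian p x = 0}"
    then have "ball z (e/2) \<subseteq> interior (p ` {x. jacobian p x = 0})"
      by (rule interior_maximal) simp
    then show False using e interior_critical_values[OF p2] by simp
  qed
  then obtain v where "v \<in> ball z (e/2)" "v \<notin> p ` {x. jacobian p x = 0}" by blast
  then have v: "dist z v < e/2" "\<And>x. p x = v \<Longrightarrow> jacobian p x \<noteq> 0" by auto
  show thesis
  proof (rule that[of "\<lambda>x. p x + (z - v)"])
    show "smooth (\<lambda>x. p x + (z - v))" by (rule smooth_translate[OF sp])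
    show "regular_value_on (\<lambda>x. p x + (z - v)) A z" for A
      using v(2) unfolding regular_value_on_def jacobian_translate[OF p2] by (auto simp: algebra_simps)
    fix x assume "x \<in> K"
    have "dist (p x + (z - v)) (y x) = norm ((p x - y x) + (z - v))"
      by (simp add: dist_norm algebra_simps)
    also have "\<dots> \<le> norm (p x - y x) + norm (z - v)" by (rule norm_triangle_ineq)
    also have "\<dots> < e/2 + e/2"
      using p(2)[OF \<open>x \<in> K\<close>] v(1) by (intro add_strict_mono) (auto simp: dist_norm norm_minus_commute)
    finally show "dist (p x + (z - v)) (y x) < e" by simp
  qed
qed

text \<open>At a frontier point \<open>w\<close> both maps take values in the open ball around
  \<open>y w\<close> of radius \<open>dist (y w) z\<close>. This ball is convex and does not contain
  \<open>z\<close>, so the segment homotopy never hits \<open>z\<close> on the frontier.\<close>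

lemma signed_count_eq:
  fixes g g' :: "real^'n \<Rightarrow> real^'n"
  assumes A: "open A" "bounded A" and g: "C_order 2 g" "C_order 2 g'"
    and reg: "regular_value_on g A z" "regular_value_on g' A z"
    and close: "\<And>w. w \<in> frontier A \<Longrightarrow> dist (g w) (y w) < dist (y w) z"
      "\<And>w. w \<in> frontier A \<Longrightarrow> dist (g' w) (y w) < dist (y w) z"
  shows "signed_count g' A z = signed_count g A z"
proof -
  have "C_order 2 (\<lambda>x. g' x - g x)"
    using C_order_affine[OF g(2,1), of "-1"] by simp
  moreover have "g w + t *\<^sub>R (g' w - g w) \<noteq> z" if t: "t \<in> {0..1}" and w: "w \<in> frontier A" for t w
  proof -
    have "convex (ball (y w) (dist (y w) z))" by simp
    moreover have "g w \<in> ball (y w) (dist (y w) z)" "g' w \<in> ball (y w) (dist (y w) z)"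
      using close[OF w] by (auto simp: dist_commute)
    ultimately have "(1 - t) *\<^sub>R g w + t *\<^sub>R g' w \<in> ball (y w) (dist (y w) z)"
      using t by (intro convexD_alt) auto
    moreover have "(1 - t) *\<^sub>R g w + t *\<^sub>R g' w = g w + t *\<^sub>R (g' w - g w)"
      by (simp add: algebra_simps)
    ultimately show ?thesis by auto
  qed
  ultimately show ?thesis
    using signed_count_homotopy[OF A g(1), of "\<lambda>x. g' x - g x" z] reg by simp
qed

lemma signed_count_int: "\<exists>k. real_of_int k = signed_count g A z"
proof -
  have "sgn r \<in> \<int>" for r :: real by (auto simp: sgn_if)
  then have "signed_count g A z \<in> \<int>"
    unfolding signed_count_def by (intro Ints_sum) auto
  then show ?thesis by (metis Ints_cases)
qed

text \<open>Closeness is asked only on the frontier and pointwise, which is weaker than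
  \<open>degree_approximant\<close>. It suffices because \<open>signed_count_eq\<close> measures
  closeness on the frontier alone.\<close>

lemma brouwer_deg_eq_signed_count:
  fixes y :: "real^'n \<Rightarrow> real^'n"
  assumes A: "open A" "bounded A" and y: "continuous_on (closure A) y" "z \<notin> y ` frontier A"
    and g: "smooth g" "regular_value_on g A z"
      "\<And>w. w \<in> frontier A \<Longrightarrow> dist (g w) (y w) < dist (y w) z"
  shows "real_of_int (brouwer_deg y A z) = signed_count g A z"
proof -
  obtain k where k: "real_of_int k = signed_count g A z"
    using signed_count_int by blast
  have eq: "signed_count g' A z = signed_count g A z" if g': "degree_approximant y A z g'" for g'
  proof (rule signed_count_eq[OF A smooth_C_order[OF g(1)] smooth_C_order g(2) _ g(3)])
    show "smooth g'" "regular_value_on g' A z"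
      using g' by (auto simp: degree_approximant_def)
    show "dist (g' w) (y w) < dist (y w) z" if "w \<in> frontier A" for w
      using g' that by (auto simp: degree_approximant_def frontier_def)
  qed
  have cl: "compact (closure A)" using A(2) by (simp add: compact_closure)
  have fr: "compact (frontier A)" using A(2) by (rule compact_frontier_bounded)
  have cfr: "continuous_on (frontier A) y"
    using y(1) by (rule continuous_on_subset) (simp add: frontier_def)
  obtain r where r: "r > 0" "\<And>w. w \<in> frontier A \<Longrightarrow> r \<le> dist (y w) z"
    using uniform_distance_from_value[OF fr cfr y(2)] by blast
  \<comment> \<open>An approximant in the strict sense of the definition has to exist: otherwise
    every integer would satisfy the universal condition and the description would not be
    unique.\<close>
  obtain g0 where g0: "smooth g0" "\<And>A. regular_value_on g0 A z"
    "\<And>x. x \<in> closure A \<Longrightarrow> dist (g0 x) (y x) < r"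
    using smooth_regular_approximation[OF cl y(1) r(1)] by blast
  have approx: "degree_approximant y A z g0"
    unfolding degree_approximant_def
  proof (intro conjI ballI g0(1,2))
    fix x w assume "x \<in> closure A" "w \<in> frontier A"
    then show "dist (g0 x) (y x) < dist (y w) z"
      using g0(3)[of x] r(2)[of w] by simp
  qed
  have "brouwer_deg y A z = k"
    unfolding brouwer_deg_def signed_count_def[symmetric]
  proof (rule the_equality)
    show "\<forall>g. degree_approximant y A z g \<longrightarrow> real_of_int k = signed_count g A z"
      using eq k by simp
    show "k' = k" if "\<forall>g. degree_approximant y A z g \<longrightarrow> real_of_int k' = signed_count g A z" for k'
    proof -
      have "real_of_int k' = real_of_int k"
        using that approx eq[OF approx] k by simp
      then show ?thesis by simp
    qed
  qed
  then show ?thesis using k by simp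
qed

text \<open>A map closer to \<open>y\<close> than the distance from \<open>z\<close> to the whole
  image has no point over \<open>z\<close>, so its signed count is an empty sum.\<close>

lemma brouwer_deg_eq_0:
  fixes y :: "real^'n \<Rightarrow> real^'n"
  assumes A: "open A" "bounded A" and y: "continuous_on (closure A) y" "z \<notin> y ` closure A"
  shows "brouwer_deg y A z = 0"
proof -
  have cl: "compact (closure A)" using A(2) by (simp add: compact_closure)
  obtain r where r: "r > 0" "\<And>w. w \<in> closure A \<Longrightarrow> r \<le> dist (y w) z"
    using uniform_distance_from_value[OF cl y] by blast
  obtain g where g: "smooth g" "\<And>A. regular_value_on g A z"
    "\<And>x. x \<in> closure A \<Longrightarrow> dist (g x) (y x) < r"
    using smooth_regular_approximation[OF cl y(1) r(1)] by blast
  have less: "dist (g w) (y w) < dist (y w) z" if "w \<in> closure A" for w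
    using g(3)[OF that] r(2)[OF that] by simp
  have "z \<notin> y ` frontier A" using y(2) by (auto simp: frontier_def)
  then have "real_of_int (brouwer_deg y A z) = signed_count g A z"
    by (rule brouwer_deg_eq_signed_count[OF A y(1) _ g(1,2)]) (simp add: less frontier_def)
  moreover have "{x\<in>A. g x = z} = {}"
  proof -
    have "g x \<noteq> z" if "x \<in> A" for x
      using less[of x] that closure_subset[of A] by (auto simp: dist_commute)
    then show ?thesis by blast
  qed
  ultimately show ?thesis by (simp only: signed_count_def sum.empty of_int_eq_0_iff)
qed

section \<open>Additivity, excision and local constancy\<close>

lemma frontier_subset_Diff:
  assumes "open A1" "open A2" "A1 \<inter> A2 = {}" "A1 \<subseteq> A"
  shows "frontier A1 \<subseteq> closure A - (A1 \<union> A2)"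
proof -
  have "closure A1 \<inter> A2 = {}"
    using assms open_Int_closure_eq_empty[of A2 A1] by (simp add: Int_commute)
  then show ?thesis
    using closure_mono[OF assms(4)] assms(1) by (auto simp: frontier_def interior_open)
qed

text \<open>\<open>K\<close> contains the frontiers of \<open>A\<close>, \<open>A1\<close> and
  \<open>A2\<close>, so one map \<open>g\<close> close enough to \<open>y\<close> computes all three
  degrees. It omits \<open>z\<close> on \<open>K\<close>, so its fibre in \<open>A\<close> splits
  into the fibres in \<open>A1\<close> and \<open>A2\<close>.\<close>

lemma brouwer_deg_additive:
  fixes y :: "real^'n \<Rightarrow> real^'n"
  assumes A: "open A" "bounded A" and y: "continuous_on (closure A) y"
    and A12: "open A1" "open A2" "A1 \<inter> A2 = {}" "A1 \<subseteq> A" "A2 \<subseteq> A"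
    and z: "z \<notin> y ` (closure A - (A1 \<union> A2))"
  shows "brouwer_deg y A z = brouwer_deg y A1 z + brouwer_deg y A2 z"
proof -
  define K where "K = closure A - (A1 \<union> A2)"
  have cl: "compact (closure A)" using A(2) by (simp add: compact_closure)
  have K: "compact K" unfolding K_def using cl A12 by (intro compact_diff) auto
  have cK: "continuous_on K y" using y by (rule continuous_on_subset) (simp add: K_def)
  obtain r where r: "r > 0" "\<And>w. w \<in> K \<Longrightarrow> r \<le> dist (y w) z"
    using uniform_distance_from_value[OF K cK] z by (auto simp: K_def)
  obtain g where g: "smooth g" "\<And>A. regular_value_on g A z"
    "\<And>x. x \<in> closure A \<Longrightarrow> dist (g x) (y x) < r"
    using smooth_regular_approximation[OF cl y r(1)] by blast
  have less: "dist (g w) (y w) < dist (y w) z" if "w \<in> K" for w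
    using g(3)[of w] r(2)[OF that] that by (simp add: K_def)
  have gK: "g w \<noteq> z" if "w \<in> K" for w
    using less[OF that] by (auto simp: dist_commute)
  have sub: "real_of_int (brouwer_deg y B z) = signed_count g B z"
    "finite {x\<in>B. g x = z}" if B: "open B" "B \<subseteq> A" "frontier B \<subseteq> K" for B
  proof -
    have b: "bounded B" using A(2) B(2) bounded_subset by blast
    have c: "continuous_on (closure B) y"
      using y closure_mono[OF B(2)] by (rule continuous_on_subset)
    have "z \<notin> y ` frontier B" using z B(3) by (auto simp: K_def)
    then show "real_of_int (brouwer_deg y B z) = signed_count g B z"
      using B(3) by (intro brouwer_deg_eq_signed_count[OF B(1) b c _ g(1,2)] less) auto
    have "z \<notin> g ` frontier B" using gK B(3) by auto
    then show "finite {x\<in>B. g x = z}"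
      by (intro finite_regular_fibre[OF smooth_C_order[OF g(1)] B(1) b g(2)])
  qed
  have fr: "frontier A \<subseteq> K" "frontier A1 \<subseteq> K" "frontier A2 \<subseteq> K"
  proof -
    show "frontier A \<subseteq> K"
      using A(1) A12(4,5) by (auto simp: frontier_def K_def interior_open)
    show "frontier A1 \<subseteq> K"
      unfolding K_def using A12 by (intro frontier_subset_Diff)
    show "frontier A2 \<subseteq> K"
      unfolding K_def Un_commute[of A1] using A12 by (intro frontier_subset_Diff) auto
  qed
  have "x \<in> A1 \<union> A2" if "x \<in> A" "g x = z" for x
    using gK[of x] that closure_subset[of A] unfolding K_def by blast
  then have "{x\<in>A. g x = z} = {x\<in>A1. g x = z} \<union> {x\<in>A2. g x = z}"
    using A12(4,5) by blast
  moreover have "{x\<in>A1. g x = z} \<inter> {x\<in>A2. g x = z} = {}"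
    using A12(3) by blast
  ultimately have "signed_count g A z = signed_count g A1 z + signed_count g A2 z"
    unfolding signed_count_def
    using sum.union_disjoint[OF sub(2)[OF A12(1,4) fr(2)] sub(2)[OF A12(2,5) fr(3)]] by simp
  then have "real_of_int (brouwer_deg y A z) = real_of_int (brouwer_deg y A1 z + brouwer_deg y A2 z)"
    using sub(1)[OF A(1) order_refl fr(1)] sub(1)[OF A12(1,4) fr(2)] sub(1)[OF A12(2,5) fr(3)] by simp
  then show ?thesis by linarith
qed

lemma brouwer_deg_excision:
  fixes y :: "real^'n \<Rightarrow> real^'n"
  assumes A: "open A" "bounded A" and y: "continuous_on (closure A) y"
    and B: "open B" "B \<subseteq> A" and z: "z \<notin> y ` (closure A - B)"
  shows "brouwer_deg y A z = brouwer_deg y B z"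
  using brouwer_deg_additive[OF A y B(1) open_empty _ B(2)] z brouwer_deg_eq_0[of "{}" y z] by simp

lemma signed_count_translate:
  fixes g :: "real^'n \<Rightarrow> real^'n"
  assumes "C_order 2 g"
  shows "signed_count (\<lambda>x. g x + c) A (z + c) = signed_count g A z"
  by (simp add: signed_count_def jacobian_translate[OF assms])

text \<open>A map that computes the degree at \<open>z'\<close>, shifted by \<open>z - z'\<close>,
  has the same signed count over \<open>z\<close> and computes the degree there.\<close>

lemma brouwer_deg_locally_constant:
  fixes y :: "real^'n \<Rightarrow> real^'n"
  assumes A: "open A" "bounded A" and y: "continuous_on (closure A) y"
    and r: "\<And>w. w \<in> frontier A \<Longrightarrow> r \<le> dist (y w) z" and z': "dist z' z < r"
  shows "brouwer_deg y A z' = brouwer_deg y A z"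
proof -
  \<comment> \<open>\<open>e\<close> is what remains of \<open>r\<close> after the move from
    \<open>z\<close> to \<open>z'\<close>: an approximation within \<open>e\<close> of
    \<open>y\<close> is still within \<open>r\<close> after the shift.\<close>
  define e where "e = r - dist z' z"
  have e: "e > 0" "e \<le> r" using z' by (simp_all add: e_def)
  have cl: "compact (closure A)" using A(2) by (simp add: compact_closure)
  have r': "e \<le> dist (y w) z'" if "w \<in> frontier A" for w
    using r[OF that] dist_triangle[of "y w" z z'] by (simp add: e_def)
  have fr: "frontier A \<subseteq> closure A" by (simp add: frontier_def)
  obtain g' where g': "smooth g'" "\<And>A. regular_value_on g' A z'"
    "\<And>x. x \<in> closure A \<Longrightarrow> dist (g' x) (y x) < e"
    using smooth_regular_approximation[OF cl y e(1)] by blast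
  have z: "z \<notin> y ` frontier A"
    using r e by fastforce
  have "z' \<notin> y ` frontier A"
    using r' e by fastforce
  then have "real_of_int (brouwer_deg y A z') = signed_count g' A z'"
  proof (rule brouwer_deg_eq_signed_count[OF A y _ g'(1,2)])
    fix w assume w: "w \<in> frontier A"
    then have "dist (g' w) (y w) < e" using fr g'(3) by blast
    then show "dist (g' w) (y w) < dist (y w) z'" using r'[OF w] by linarith
  qed
  also have "\<dots> = signed_count (\<lambda>x. g' x + (z - z')) A z"
    using signed_count_translate[OF smooth_C_order[OF g'(1)], of "z - z'" A z'] by simp
  also have "\<dots> = real_of_int (brouwer_deg y A z)"
  proof (rule brouwer_deg_eq_signed_count[OF A y z smooth_translate[OF g'(1)], symmetric])
    show "regular_value_on (\<lambda>x. g' x + (z - z')) A z"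
      using g'(2)[of A] unfolding regular_value_on_def jacobian_translate[OF smooth_C_order[OF g'(1)]]
      by (auto simp: algebra_simps)
    fix w assume w: "w \<in> frontier A"
    have "dist (g' w + (z - z')) (y w) = norm ((g' w - y w) + (z - z'))"
      by (simp add: dist_norm algebra_simps)
    also have "\<dots> \<le> norm (g' w - y w) + norm (z - z')" by (rule norm_triangle_ineq)
    also have "\<dots> = dist (g' w) (y w) + dist z' z"
      by (simp add: dist_norm norm_minus_commute)
    also have "\<dots> < r" using g'(3)[of w] w fr by (auto simp: e_def)
    also have "r \<le> dist (y w) z" by (rule r[OF w])
    finally show "dist (g' w + (z - z')) (y w) < dist (y w) z" .
  qed
  finally show ?thesis by simp
qed

subsection \<open>Strictly orientation preserving maps\<close>

lemma ex_open_relatively_compact_between: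
  fixes K V :: "'a::euclidean_space set"
  assumes "compact K" "open V" "K \<subseteq> V"
  obtains A where "open A" "K \<subseteq> A" "compact (closure A)" "closure A \<subseteq> V"
proof -
  obtain e where e: "e > 0" "(\<Union>x\<in>K. ball x e) \<subseteq> V"
    using compact_subset_open_imp_ball_epsilon_subset[OF assms] by blast
  define A where "A = (\<Union>x\<in>K. ball x (e/2))"
  have "bounded A"
  proof -
    obtain b where b: "\<And>x. x \<in> K \<Longrightarrow> norm x \<le> b"
      using compact_imp_bounded[OF assms(1)] by (auto simp: bounded_iff)
    have "norm w \<le> b + e" if w: "w \<in> A" for w
    proof -
      obtain x where x: "x \<in> K" "dist x w < e/2" using w by (auto simp: A_def)
      then show ?thesis
        using b[OF x(1)] norm_triangle_ineq2[of w x] e(1) by (simp add: dist_norm norm_minus_commute)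
    qed
    then show ?thesis by (auto simp: bounded_iff)
  qed
  moreover have "closure A \<subseteq> V"
  proof
    fix w assume "w \<in> closure A"
    then obtain a where "a \<in> A" "dist a w < e/2"
      using e(1) by (meson closure_approachable half_gt_zero)
    then obtain x where "x \<in> K" "dist x a < e/2" "dist a w < e/2" by (auto simp: A_def)
    then have "x \<in> K" "dist x w < e"
      using dist_triangle[of x w a] by auto
    then have "w \<in> (\<Union>x\<in>K. ball x e)" by auto
    then show "w \<in> V" using e(2) by (rule rev_subsetD)
  qed
  moreover have "open A" unfolding A_def by blast
  moreover have "K \<subseteq> A" using e(1) by (auto simp: A_def)
  ultimately show thesis using that by (simp add: compact_closure)
qed

lemma inner_open_iff: "A \<in> inner_open \<Omega> \<longleftrightarrow> open A \<and> compact (closure A) \<and> closure A \<subseteq> \<Omega>"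
  by (simp add: inner_open_def compactly_contained_def)

lemma inner_openD:
  fixes A :: "'a::heine_borel set"
  assumes "A \<in> inner_open \<Omega>"
  shows "open A" "bounded A" "closure A \<subseteq> \<Omega>" "compact (closure A)" "frontier A \<subseteq> \<Omega>" "A \<subseteq> \<Omega>"
    "compact (frontier A)"
proof -
  show A: "open A" "bounded A" "closure A \<subseteq> \<Omega>" "compact (closure A)"
    using assms by (simp_all add: inner_open_iff compact_closure)
  show "frontier A \<subseteq> \<Omega>" "A \<subseteq> \<Omega>"
    using A(3) closure_subset[of A] by (auto simp: frontier_def)
  show "compact (frontier A)"
    using A(2) by (rule compact_frontier_bounded)
qed

lemma inner_open_subset:
  fixes A :: "'a::heine_borel set"
  assumes "A \<in> inner_open \<Omega>" "open B" "B \<subseteq> A"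
  shows "B \<in> inner_open \<Omega>"
proof -
  have "bounded B" using inner_openD(2)[OF assms(1)] assms(3) by (rule bounded_subset)
  moreover have "closure B \<subseteq> \<Omega>"
    using closure_mono[OF assms(3)] inner_openD(3)[OF assms(1)] by (rule subset_trans)
  ultimately show ?thesis using assms(2) by (simp add: inner_open_iff compact_closure)
qed

lemma inner_open_Un:
  fixes A :: "'a::heine_borel set"
  assumes "A \<in> inner_open \<Omega>" "B \<in> inner_open \<Omega>"
  shows "A \<union> B \<in> inner_open \<Omega>"
  using assms by (auto simp: inner_open_iff compact_Un)

lemma frontier_Diff_closure_subset:
  assumes "open A" "open B"
  shows "frontier (A - closure B) \<subseteq> frontier A \<union> frontier B"
proof -
  have "closure (A - closure B) \<subseteq> closure A - B"
    using closure_mono[of "A - closure B" A] open_Int_closure_eq_empty[OF assms(2), of "A - closure B"]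
      closure_subset[of B] by blast
  then show ?thesis
    using assms by (auto simp: frontier_def interior_open open_Diff)
qed

lemma inner_open_Diff_closure:
  fixes A :: "'a::heine_borel set"
  assumes "A \<in> inner_open \<Omega>" "open B"
  shows "A - closure B \<in> inner_open \<Omega>"
  by (rule inner_open_subset[OF assms(1)]) (auto simp: open_Diff inner_openD(1)[OF assms(1)])

section \<open>Consequences of strict orientation preservation\<close>

locale strictly_orientation_preserving_map =
  fixes \<Omega> :: "(real^'n) set" and y :: "real^'n \<Rightarrow> real^'n"
  assumes open_domain: "open \<Omega>" and cont: "continuous_on \<Omega> y"
    and sop: "strictly_orientation_preserving \<Omega> y"
begin

lemma cont_closure: "A \<in> inner_open \<Omega> \<Longrightarrow> continuous_on (closure A) y"
  using cont inner_openD(3) continuous_on_subset by blast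

lemma deg_nonneg: "A \<in> inner_open \<Omega> \<Longrightarrow> z \<notin> y ` frontier A \<Longrightarrow> 0 \<le> brouwer_deg y A z"
  using sop by (auto simp: strictly_orientation_preserving_def orientation_preserving_def)

lemma deg_near:
  assumes A: "A \<in> inner_open \<Omega>" and z: "z \<notin> y ` frontier A"
  obtains \<rho> where "\<rho> > 0"
    "\<And>z'. dist z' z < \<rho> \<Longrightarrow> z' \<notin> y ` frontier A \<and> brouwer_deg y A z' = brouwer_deg y A z"
proof -
  note A' = inner_openD[OF A]
  obtain r where r: "r > 0" "\<And>w. w \<in> frontier A \<Longrightarrow> r \<le> dist (y w) z"
    using uniform_distance_from_value[OF A'(7) continuous_on_subset[OF cont A'(5)] z] by blast
  have "z' \<notin> y ` frontier A \<and> brouwer_deg y A z' = brouwer_deg y A z" if "dist z' z < r" for z'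
    using brouwer_deg_locally_constant[OF A'(1,2) cont_closure[OF A] r(2) that] r(2) that by force
  then show thesis using that r(1) by blast
qed

lemma deg_pos_imp_value:
  assumes A: "A \<in> inner_open \<Omega>" and z: "z \<notin> y ` frontier A" and d: "brouwer_deg y A z \<noteq> 0"
  shows "z \<in> y ` A"
proof (rule ccontr)
  assume "z \<notin> y ` A"
  moreover have "closure A \<subseteq> A \<union> frontier A"
    using inner_openD(1)[OF A] by (auto simp: frontier_def interior_open)
  ultimately have "z \<notin> y ` closure A" using z by blast
  then show False
    using brouwer_deg_eq_0[OF inner_openD(1,2)[OF A] cont_closure[OF A]] d by blast
qed

lemma deg_disjoint_Un:
  assumes A: "A \<in> inner_open \<Omega>" and B: "B \<in> inner_open \<Omega>" and "A \<inter> B = {}"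
    and z: "z \<notin> y ` frontier A" "z \<notin> y ` frontier B"
  shows "z \<notin> y ` frontier (A \<union> B)" "brouwer_deg y (A \<union> B) z = brouwer_deg y A z + brouwer_deg y B z"
proof -
  note A' = inner_openD[OF A] and B' = inner_openD[OF B]
  have sub: "closure (A \<union> B) - (A \<union> B) \<subseteq> frontier A \<union> frontier B"
    using A'(1) B'(1) by (auto simp: frontier_def interior_open)
  then show "z \<notin> y ` frontier (A \<union> B)"
    using z A'(1) B'(1) by (auto simp: frontier_def interior_open open_Un)
  show "brouwer_deg y (A \<union> B) z = brouwer_deg y A z + brouwer_deg y B z"
    using sub z assms(3) A'(1,2) B'(1,2)
    by (intro brouwer_deg_additive cont_closure inner_open_Un[OF A B]) auto
qed

text \<open>The degree on \<open>A\<close> is that on \<open>B\<close> plus that on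
  \<open>A - closure B\<close>, and orientation preservation makes the second summand nonnegative.
  The frontier of \<open>B\<close>, which is lost between the two, contains no point over
  \<open>z\<close>.\<close>

lemma deg_mono:
  assumes A: "A \<in> inner_open \<Omega>" and B: "B \<in> inner_open \<Omega>" and "B \<subseteq> A"
    and z: "z \<notin> y ` frontier A" "z \<notin> y ` frontier B"
  shows "brouwer_deg y B z \<le> brouwer_deg y A z"
proof -
  note A' = inner_openD[OF A] and B' = inner_openD[OF B]
  let ?D = "A - closure B"
  have D: "?D \<in> inner_open \<Omega>" by (rule inner_open_Diff_closure[OF A B'(1)])
  have "z \<notin> y ` frontier ?D"
    using frontier_Diff_closure_subset[OF A'(1) B'(1)] z by blast
  then have "0 \<le> brouwer_deg y ?D z" by (rule deg_nonneg[OF D])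
  moreover have "brouwer_deg y A z = brouwer_deg y B z + brouwer_deg y ?D z"
  proof (rule brouwer_deg_additive[OF A'(1,2) cont_closure[OF A] B'(1) inner_openD(1)[OF D]])
    show "B \<inter> ?D = {}" using closure_subset[of B] by blast
    show "z \<notin> y ` (closure A - (B \<union> ?D))"
      using z A'(1) B'(1) by (auto simp: frontier_def interior_open)
  qed (use \<open>B \<subseteq> A\<close> in auto)
  ultimately show ?thesis by simp
qed

text \<open>Nondegeneracy concerns compactly contained sets and values not yet known to be attained.
  A ball inside \<open>V\<close> settles the first point; a value of nonzero degree is attained,
  which supplies \<open>x\<close>.\<close>

lemma nondegenerate_open:
  assumes "open V" "V \<noteq> {}" "V \<subseteq> \<Omega>"
  obtains A x where "A \<in> inner_open \<Omega>" "A \<subseteq> V" "x \<in> A" "y x \<notin> y ` frontier A"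
    "1 \<le> brouwer_deg y A (y x)"
proof -
  obtain x e where x: "e > 0" "cball x e \<subseteq> V"
    using assms(1,2) open_contains_cball by (metis ex_in_conv)
  have "ball x e \<in> inner_open \<Omega>"
    using x assms(3) by (auto simp: inner_open_iff)
  moreover have "ball x e \<noteq> {}" using x(1) by simp
  ultimately obtain A z where A: "A \<in> inner_open \<Omega>" "A \<subseteq> ball x e" "z \<notin> y ` frontier A"
      "brouwer_deg y A z \<noteq> 0"
    using sop unfolding strictly_orientation_preserving_def nondegenerate_def by blast
  obtain w where w: "w \<in> A" "y w = z"
    using deg_pos_imp_value[OF A(1,3,4)] by blast
  have "A \<subseteq> V" using A(2) x(2) ball_subset_cball[of x e] by blast
  moreover have "1 \<le> brouwer_deg y A z" using deg_nonneg[OF A(1,3)] A(4) by linarith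
  ultimately show thesis using that[OF A(1) _ w(1)] w(2) A(3) by simp
qed

text \<open>Nondegeneracy gives positive degree only at some value \<open>y w\<close> near
  \<open>y x\<close>, on a small set \<open>B\<close>. With \<open>B\<close> inside
  \<open>V\<close>, that value is close enough for the degree on \<open>A\<close> to be the same as
  at \<open>y x\<close>, and monotonicity passes from \<open>B\<close> to \<open>A\<close>.\<close>

lemma deg_ge_1:
  assumes A: "A \<in> inner_open \<Omega>" and x: "x \<in> A" and z: "y x \<notin> y ` frontier A"
  shows "1 \<le> brouwer_deg y A (y x)"
proof -
  note A' = inner_openD[OF A]
  obtain \<rho> where \<rho>: "\<rho> > 0" "\<And>z'. dist z' (y x) < \<rho> \<Longrightarrow>
      z' \<notin> y ` frontier A \<and> brouwer_deg y A z' = brouwer_deg y A (y x)"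
    using deg_near[OF A z] by blast
  define V where "V = A \<inter> y -` ball (y x) \<rho>"
  have "open V"
    unfolding V_def
    using continuous_on_subset[OF cont A'(6)] A'(1) by (intro continuous_open_preimage) auto
  moreover have "x \<in> V" using x \<rho>(1) by (simp add: V_def)
  moreover have "V \<subseteq> \<Omega>" using A'(6) by (auto simp: V_def)
  ultimately obtain B w where B: "B \<in> inner_open \<Omega>" "B \<subseteq> V" "w \<in> B" "y w \<notin> y ` frontier B"
    "1 \<le> brouwer_deg y B (y w)"
    using nondegenerate_open[of V] by blast
  have "dist (y w) (y x) < \<rho>" using B(2,3) by (auto simp: V_def dist_commute)
  note near = \<rho>(2)[OF this]
  have "1 \<le> brouwer_deg y B (y w)" by (rule B(5))
  also have "\<dots> \<le> brouwer_deg y A (y w)"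
  proof (rule deg_mono[OF A B(1) _ _ B(4)])
    show "B \<subseteq> A" using B(2) by (auto simp: V_def)
    show "y w \<notin> y ` frontier A" using near ..
  qed
  also have "\<dots> = brouwer_deg y A (y x)" using near ..
  finally show ?thesis .
qed

lemma reg_set_iff:
  "x \<in> reg_set \<Omega> y \<Omega> \<longleftrightarrow> (\<exists>A\<in>inner_open \<Omega>. x \<in> A \<and> y x \<notin> y ` frontier A)"
  using inner_openD(6) unfolding reg_set_def by blast

lemma reg_setI: "A \<in> inner_open \<Omega> \<Longrightarrow> x \<in> A \<Longrightarrow> y x \<notin> y ` frontier A \<Longrightarrow> x \<in> reg_set \<Omega> y \<Omega>"
  by (auto simp: reg_set_iff)

lemma im_loc_eq: "im_loc \<Omega> y \<Omega> = y ` reg_set \<Omega> y \<Omega>"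
proof
  show "im_loc \<Omega> y \<Omega> \<subseteq> y ` reg_set \<Omega> y \<Omega>"
  proof
    fix z assume "z \<in> im_loc \<Omega> y \<Omega>"
    then obtain A where A: "A \<in> inner_open \<Omega>" "z \<notin> y ` frontier A" "brouwer_deg y A z \<noteq> 0"
      by (auto simp: im_loc_def im_T_def)
    obtain x where "x \<in> A" "y x = z" using deg_pos_imp_value[OF A] by blast
    then show "z \<in> y ` reg_set \<Omega> y \<Omega>" using reg_setI[OF A(1)] A(2) by blast
  qed
  show "y ` reg_set \<Omega> y \<Omega> \<subseteq> im_loc \<Omega> y \<Omega>"
  proof clarify
    fix x assume "x \<in> reg_set \<Omega> y \<Omega>"
    then obtain A where A: "A \<in> inner_open \<Omega>" "x \<in> A" "y x \<notin> y ` frontier A"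
      by (auto simp: reg_set_iff)
    then have "y x \<in> im_T y A" using deg_ge_1[OF A] by (simp add: im_T_def)
    then show "y x \<in> im_loc \<Omega> y \<Omega>"
      using A(1) inner_openD(6)[OF A(1)] unfolding im_loc_def by blast
  qed
qed

lemma interior_irregular_set: "interior (\<Omega> - reg_set \<Omega> y \<Omega>) = {}"
proof (rule ccontr)
  let ?V = "interior (\<Omega> - reg_set \<Omega> y \<Omega>)"
  assume "?V \<noteq> {}"
  moreover have sub: "?V \<subseteq> \<Omega> - reg_set \<Omega> y \<Omega>" by (rule interior_subset)
  ultimately obtain A x where A: "A \<in> inner_open \<Omega>" "A \<subseteq> ?V" "x \<in> A" "y x \<notin> y ` frontier A"
    using nondegenerate_open[of ?V] by (metis Diff_subset open_interior subset_trans)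
  then show False using reg_setI[OF A(1,3,4)] sub by blast
qed

text \<open>If the closure of \<open>C\<close> avoided the frontier it would lie in
  \<open>\<Omega>\<close>, where the fibre is relatively closed. As components are closed in the
  fibre, \<open>C\<close> would be compact, and its points would turn out to be regular, against the
  choice of \<open>z\<close>.\<close>

lemma closure_component_meets_frontier:
  assumes bd: "bounded \<Omega>" and z: "z \<notin> y ` reg_set \<Omega> y \<Omega>" and C: "C \<in> components (\<Omega> \<inter> y -` {z})"
  shows "closure C \<inter> frontier \<Omega> \<noteq> {}"
proof
  assume disj: "closure C \<inter> frontier \<Omega> = {}"
  let ?F = "\<Omega> \<inter> y -` {z}"
  have CF: "C \<subseteq> ?F" "C \<noteq> {}" using C in_components_subset in_components_nonempty by blast+
  have "closure C \<subseteq> closure \<Omega>" using CF(1) by (intro closure_mono) blast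
  then have sub: "closure C \<subseteq> \<Omega>"
    using disj open_domain by (auto simp: frontier_def interior_open)
  have Fcl: "closedin (top_of_set \<Omega>) ?F"
    by (rule continuous_closedin_preimage[OF cont]) simp
  obtain T where T: "closed T" "?F = \<Omega> \<inter> T"
    using Fcl by (auto simp: closedin_closed)
  have "closure C \<subseteq> T"
    using CF(1) T by (intro closure_minimal) auto
  then have "closure C \<subseteq> ?F" using sub T(2) by blast
  moreover obtain T' where "closed T'" "C = ?F \<inter> T'"
    using closedin_component[OF C] by (auto simp: closedin_closed)
  moreover from this have "closure C \<subseteq> T'" by (intro closure_minimal) auto
  ultimately have "closure C = C" using closure_subset[of C] by blast
  moreover have "bounded C" using CF(1) bd by (meson bounded_subset le_infE)
  ultimately have comp: "compact C" by (metis compact_closure)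
  have lc: "locally compact ?F"
    unfolding locally_compact_closed_Int_open
    using T open_domain by (intro exI[of _ T] exI[of _ \<Omega>]) (simp add: Int_commute)
  obtain K where K: "openin (top_of_set ?F) K" "compact K" "C \<subseteq> K" "K \<subseteq> \<Omega>"
    using Sura_Bura_clopen_subset[OF lc C comp open_domain] CF(1) by blast
  obtain U where U: "open U" "K = ?F \<inter> U"
    using K(1) by (auto simp: openin_open)
  \<comment> \<open>\<open>U\<close> cuts \<open>K\<close> out of the fibre, so every point over
    \<open>z\<close> in \<open>closure A\<close> lies in \<open>K\<close> and thus in the open set
    \<open>A\<close>; none is left for the frontier.\<close>
  obtain A where A: "open A" "K \<subseteq> A" "compact (closure A)" "closure A \<subseteq> \<Omega> \<inter> U"
    by (rule ex_open_relatively_compact_between[OF K(2) open_Int[OF open_domain U(1)]])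
      (use K(4) U(2) in auto)
  have Ain: "A \<in> inner_open \<Omega>" using A by (simp add: inner_open_iff)
  have "z \<notin> y ` frontier A"
  proof
    assume "z \<in> y ` frontier A"
    then obtain w where w: "w \<in> frontier A" "y w = z" by blast
    then have "w \<in> K" using A(4) U(2) by (auto simp: frontier_def)
    then show False using w(1) A(1,2) by (auto simp: frontier_def interior_open)
  qed
  moreover obtain c where "c \<in> C" using CF(2) by blast
  moreover from this have "y c = z" "c \<in> A" using CF(1) K(3) A(2) by auto
  ultimately have "c \<in> reg_set \<Omega> y \<Omega>" using reg_setI[OF Ain] by blast
  then show False using z \<open>y c = z\<close> by blast
qed

end

section \<open>Maps of degree at most one\<close>

locale degree_one_map = strictly_orientation_preserving_map +
  assumes deg_le_1: "A \<in> inner_open \<Omega> \<Longrightarrow> z \<notin> y ` frontier A \<Longrightarrow> brouwer_deg y A z \<le> 1"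
begin

lemma deg_eq_1:
  assumes "A \<in> inner_open \<Omega>" "x \<in> A" "y x \<notin> y ` frontier A"
  shows "brouwer_deg y A (y x) = 1"
  using deg_ge_1[OF assms] deg_le_1[OF assms(1,3)] by simp

text \<open>Degrees of disjoint sets add up, so two of them covering the same value would give degree 2.\<close>

lemma no_disjoint_preimages:
  assumes A: "A \<in> inner_open \<Omega>" and B: "B \<in> inner_open \<Omega>" and "A \<inter> B = {}"
    and z: "z \<notin> y ` frontier A" "z \<notin> y ` frontier B"
    and d: "1 \<le> brouwer_deg y A z" "1 \<le> brouwer_deg y B z"
  shows False
  using deg_disjoint_Un[OF A B assms(3) z] deg_le_1[OF inner_open_Un[OF A B]] d by fastforce

text \<open>A regular point over \<open>y x\<close> outside \<open>closure A\<close> would have a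
  witness \<open>B\<close>, and \<open>B - closure A\<close> would be disjoint from \<open>A\<close>
  with degree at least 1 at the same value. Thus a single \<open>A\<close> captures the whole
  regular fibre, which is how compactness arises.\<close>

lemma reg_set_fibre_eq:
  assumes A: "A \<in> inner_open \<Omega>" and x: "x \<in> A" and z: "y x \<notin> y ` frontier A"
  shows "reg_set \<Omega> y \<Omega> \<inter> y -` {y x} = closure A \<inter> y -` {y x}"
proof
  note A' = inner_openD[OF A]
  show "closure A \<inter> y -` {y x} \<subseteq> reg_set \<Omega> y \<Omega> \<inter> y -` {y x}"
  proof clarify
    fix w assume w: "w \<in> closure A" "y w = y x"
    then have "w \<notin> frontier A" using z by (metis imageI)
    then have "w \<in> A" using w(1) A'(1) by (auto simp: frontier_def interior_open)
    then show "w \<in> reg_set \<Omega> y \<Omega> \<inter> y -` {y x}" using reg_setI[OF A] w(2) z by auto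
  qed
  show "reg_set \<Omega> y \<Omega> \<inter> y -` {y x} \<subseteq> closure A \<inter> y -` {y x}"
  proof clarify
    fix w assume w: "w \<in> reg_set \<Omega> y \<Omega>" "y w = y x"
    obtain B where B: "B \<in> inner_open \<Omega>" "w \<in> B" "y w \<notin> y ` frontier B"
      using w(1) by (auto simp: reg_set_iff)
    have "w \<in> closure A"
    proof (rule ccontr)
      assume "w \<notin> closure A"
      then have wD: "w \<in> B - closure A" using B(2) by blast
      have D: "B - closure A \<in> inner_open \<Omega>" by (rule inner_open_Diff_closure[OF B(1) A'(1)])
      have fD: "y w \<notin> y ` frontier (B - closure A)"
        using frontier_Diff_closure_subset[OF inner_openD(1)[OF B(1)] A'(1)] B(3) z w(2) by auto
      show False
        using no_disjoint_preimages[OF A D _ z] fD deg_ge_1[OF A x z] deg_ge_1[OF D wD fD] w(2)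
          closure_subset[of A] by auto
    qed
    then show "w \<in> closure A \<inter> y -` {y x}" using w(2) by simp
  qed
qed

lemma reg_set_fibre:
  assumes "z \<in> y ` reg_set \<Omega> y \<Omega>"
  shows "connected (reg_set \<Omega> y \<Omega> \<inter> y -` {z})"
    and "reg_set \<Omega> y \<Omega> \<inter> y -` {z} \<subset>\<subset> reg_set \<Omega> y \<Omega>"
proof -
  obtain A x where A: "A \<in> inner_open \<Omega>" "x \<in> A" "y x \<notin> y ` frontier A" and zx: "z = y x"
    using assms by (auto simp: reg_set_iff)
  note A' = inner_openD[OF A(1)]
  let ?K = "reg_set \<Omega> y \<Omega> \<inter> y -` {z}"
  have K: "?K = closure A \<inter> y -` {z}"
    using reg_set_fibre_eq[OF A] zx by simp
  have KA: "?K \<subseteq> A"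
  proof
    fix w assume "w \<in> ?K"
    then have "w \<in> closure A" "y w = z" unfolding K by auto
    moreover from this have "w \<notin> frontier A" using A(3) zx by (metis imageI)
    ultimately show "w \<in> A" using A'(1) by (auto simp: frontier_def interior_open)
  qed
  have cK: "closed ?K"
    unfolding K by (rule continuous_closed_preimage[OF cont_closure[OF A(1)]]) auto
  have compK: "compact ?K"
    using cK A'(4) unfolding K by (metis compact_Int_closed Int_absorb1 Int_lower1 inf.idem inf.left_idem)
  show "?K \<subset>\<subset> reg_set \<Omega> y \<Omega>"
    using compK cK by (simp add: compactly_contained_def closure_closed)
  show "connected ?K"
    unfolding connected_closed_set[OF cK]
  proof clarify
    fix K1 K2 assume cl: "closed K1" "closed K2" and ne: "K1 \<noteq> {}" "K2 \<noteq> {}"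
      and un: "K1 \<union> K2 = ?K" and dis: "K1 \<inter> K2 = {}"
    obtain U V where UV: "open U" "open V" "K1 \<subseteq> U" "K2 \<subseteq> V" "U \<inter> V = {}"
      using separation_normal[OF cl dis] by blast
    \<comment> \<open>\<open>L\<close> and \<open>L'\<close> are the two halves of the fibre in
      either order. A frontier point of \<open>A \<inter> T\<close> over \<open>z\<close> would lie
      in \<open>L\<close>, hence in the open set \<open>A \<inter> T\<close> itself, or in
      \<open>L'\<close>, hence in \<open>T'\<close>, which is disjoint from the closure of
      \<open>T\<close>.\<close>
    have piece: "A \<inter> T \<in> inner_open \<Omega> \<and> z \<notin> y ` frontier (A \<inter> T) \<and> 1 \<le> brouwer_deg y (A \<inter> T) z"
      if T: "open T" "open T'" "L \<subseteq> T" "L' \<subseteq> T'" "T \<inter> T' = {}" "L \<union> L' = ?K" "L \<noteq> {}" for T T' L L'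
    proof -
      have AT: "A \<inter> T \<in> inner_open \<Omega>"
        using inner_open_subset[OF A(1)] A'(1) T(1) by blast
      have fr: "z \<notin> y ` frontier (A \<inter> T)"
      proof
        assume "z \<in> y ` frontier (A \<inter> T)"
        then obtain w where w: "w \<in> frontier (A \<inter> T)" "y w = z" by blast
        then have "w \<in> closure A" using closure_mono[of "A \<inter> T" A] by (auto simp: frontier_def)
        then have wK: "w \<in> ?K" unfolding K using w(2) by simp
        then have "w \<in> L \<or> w \<in> L'" using T(6) by blast
        moreover have "w \<notin> T'"
          using w(1) open_Int_closure_eq_empty[OF T(2), of "A \<inter> T"] T(5) by (auto simp: frontier_def)
        ultimately have "w \<in> A \<inter> T" using T(3,4) wK KA by blast
        then show False using w(1) inner_openD(1)[OF AT] frontier_disjoint_eq[of "A \<inter> T"] by blast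
      qed
      obtain l where l: "l \<in> L" using T(7) by blast
      then have "l \<in> A \<inter> T" "y l = z" using T(3,6) KA by auto
      then show ?thesis using deg_ge_1[OF AT, of l] AT fr by blast
    qed
    have p1: "A \<inter> U \<in> inner_open \<Omega> \<and> z \<notin> y ` frontier (A \<inter> U) \<and> 1 \<le> brouwer_deg y (A \<inter> U) z"
      using piece[OF UV un ne(1)] .
    have p2: "A \<inter> V \<in> inner_open \<Omega> \<and> z \<notin> y ` frontier (A \<inter> V) \<and> 1 \<le> brouwer_deg y (A \<inter> V) z"
      using UV un ne(2) by (intro piece[of V U K2 K1]) auto
    have "(A \<inter> U) \<inter> (A \<inter> V) = {}" using UV(5) by blast
    then show False
      using no_disjoint_preimages p1 p2 by blast
  qed
qed

lemma im_loc_continuous_closure: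
  assumes bd: "bounded \<Omega>" and contc: "continuous_on (closure \<Omega>) y"
  shows "im_loc \<Omega> y \<Omega> = y ` \<Omega> - y ` frontier \<Omega>"
    and "z \<in> im_loc \<Omega> y \<Omega> \<Longrightarrow> brouwer_deg y \<Omega> z = 1"
proof -
  \<comment> \<open>The fibre over \<open>y x\<close> in \<open>closure \<Omega>\<close> is compact
    and avoids the frontier, so a compactly contained \<open>A\<close> surrounds it. This
    \<open>A\<close> makes \<open>x\<close> regular, and excision gives \<open>\<Omega>\<close> the
    degree of \<open>A\<close>.\<close>
  have reg: "x \<in> reg_set \<Omega> y \<Omega> \<and> brouwer_deg y \<Omega> (y x) = 1"
    if x: "x \<in> \<Omega>" and z: "y x \<notin> y ` frontier \<Omega>" for x
  proof -
    define F where "F = closure \<Omega> \<inter> y -` {y x}"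
    have "closed F"
      unfolding F_def by (rule continuous_closed_preimage[OF contc]) auto
    moreover have "bounded F"
      using bounded_closure[OF bd] unfolding F_def by (rule bounded_subset) blast
    ultimately have F: "compact F" by (simp add: compact_eq_bounded_closed)
    have "F \<subseteq> \<Omega>"
    proof
      fix w assume "w \<in> F"
      then have w: "w \<in> closure \<Omega>" "y w = y x" by (auto simp: F_def)
      then have "w \<notin> frontier \<Omega>" using z by (metis imageI)
      then show "w \<in> \<Omega>" using w(1) open_domain by (auto simp: frontier_def interior_open)
    qed
    then obtain A where A: "open A" "F \<subseteq> A" "compact (closure A)" "closure A \<subseteq> \<Omega>"
      using ex_open_relatively_compact_between[OF F open_domain] by blast
    have Ain: "A \<in> inner_open \<Omega>" using A by (simp add: inner_open_iff)
    have xA: "x \<in> A" using A(2) x closure_subset by (auto simp: F_def)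
    have "y x \<notin> y ` frontier A"
    proof
      assume "y x \<in> y ` frontier A"
      then obtain w where w: "w \<in> frontier A" "y w = y x" by (metis imageE)
      then have "w \<in> F" using A(4) closure_subset[of \<Omega>] by (auto simp: F_def frontier_def)
      then show False using w(1) A(1,2) by (auto simp: frontier_def interior_open)
    qed
    then have "x \<in> reg_set \<Omega> y \<Omega>" "brouwer_deg y A (y x) = 1"
      using reg_setI[OF Ain xA] deg_eq_1[OF Ain xA] by blast+
    moreover have "brouwer_deg y \<Omega> (y x) = brouwer_deg y A (y x)"
    proof (rule brouwer_deg_excision[OF open_domain bd contc A(1)])
      show "A \<subseteq> \<Omega>" by (rule inner_openD(6)[OF Ain])
      show "y x \<notin> y ` (closure \<Omega> - A)" using A(2) by (auto simp: F_def)
    qed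
    ultimately show ?thesis by simp
  qed
  \<comment> \<open>If a frontier point \<open>w\<close> had the value \<open>y x\<close>,
    continuity at \<open>w\<close> would give an open set near \<open>w\<close>, off
    \<open>closure A\<close>, with values close to \<open>y x\<close>. Nondegeneracy there produces
    a set disjoint from \<open>A\<close> that shares with \<open>A\<close> a value of positive
    degree.\<close>
  have avoid: "y x \<notin> y ` frontier \<Omega>" if x: "x \<in> reg_set \<Omega> y \<Omega>" for x
  proof
    assume "y x \<in> y ` frontier \<Omega>"
    then obtain w where w: "w \<in> frontier \<Omega>" "y w = y x" by (metis imageE)
    obtain A where A: "A \<in> inner_open \<Omega>" "x \<in> A" "y x \<notin> y ` frontier A"
      using x by (auto simp: reg_set_iff)
    note A' = inner_openD[OF A(1)]
    obtain \<rho> where \<rho>: "\<rho> > 0" "\<And>z'. dist z' (y x) < \<rho> \<Longrightarrow>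
        z' \<notin> y ` frontier A \<and> brouwer_deg y A z' = brouwer_deg y A (y x)"
      using deg_near[OF A(1,3)] by blast
    have wcl: "w \<in> closure \<Omega>" "w \<notin> \<Omega>"
      using w(1) open_domain by (auto simp: frontier_def interior_open)
    have "\<exists>d>0. \<forall>v\<in>closure \<Omega>. dist v w < d \<longrightarrow> dist (y v) (y w) < \<rho>"
      using contc[unfolded continuous_on_iff, rule_format, OF wcl(1) \<rho>(1)] .
    then obtain d where d: "d > 0" "\<And>v. v \<in> closure \<Omega> \<Longrightarrow> dist v w < d \<Longrightarrow> dist (y v) (y w) < \<rho>"
      by (elim exE conjE) (rule that, assumption, drule (1) bspec, drule (1) mp)
    \<comment> \<open>\<open>w\<close> is a limit of points of \<open>\<Omega>\<close> and does not
      lie in \<open>closure A\<close>, which keeps \<open>V\<close> nonempty.\<close>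
    define V where "V = (\<Omega> - closure A) \<inter> ball w d"
    have "open V" unfolding V_def using open_domain by (intro open_Int open_Diff) auto
    moreover have "V \<subseteq> \<Omega>" by (auto simp: V_def)
    moreover have "V \<noteq> {}"
    proof -
      have "w \<notin> closure A" using A'(3) wcl(2) by blast
      then have "open (ball w d - closure A)" "w \<in> ball w d - closure A"
        using d(1) by auto
      then have "(ball w d - closure A) \<inter> \<Omega> \<noteq> {}"
        using wcl(1) open_Int_closure_eq_empty[of "ball w d - closure A" \<Omega>] by blast
      then show ?thesis unfolding V_def by blast
    qed
    ultimately obtain B v where B: "B \<in> inner_open \<Omega>" "B \<subseteq> V" "v \<in> B" "y v \<notin> y ` frontier B"
      "1 \<le> brouwer_deg y B (y v)"
      using nondegenerate_open[of V] by blast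
    have "v \<in> closure \<Omega>" "dist v w < d"
      using B(2,3) closure_subset[of \<Omega>] by (auto simp: V_def dist_commute)
    then have "dist (y v) (y x) < \<rho>" using d(2)[of v] w(2) by simp
    note near = \<rho>(2)[OF this]
    have "A \<inter> B = {}" using B(2) closure_subset[of A] by (auto simp: V_def)
    moreover have "1 \<le> brouwer_deg y A (y v)" using near deg_ge_1[OF A] by simp
    ultimately show False
      using no_disjoint_preimages[OF A(1) B(1) _ _ B(4)] near B(5) by blast
  qed
  have R: "reg_set \<Omega> y \<Omega> \<subseteq> \<Omega>" by (auto simp: reg_set_def)
  show "im_loc \<Omega> y \<Omega> = y ` \<Omega> - y ` frontier \<Omega>"
    unfolding im_loc_eq
  proof
    show "y ` reg_set \<Omega> y \<Omega> \<subseteq> y ` \<Omega> - y ` frontier \<Omega>"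
      using avoid R by (intro subsetI DiffI) (auto dest: avoid)
    show "y ` \<Omega> - y ` frontier \<Omega> \<subseteq> y ` reg_set \<Omega> y \<Omega>"
      using reg by blast
  qed
  assume "z \<in> im_loc \<Omega> y \<Omega>"
  then obtain x where "x \<in> reg_set \<Omega> y \<Omega>" "z = y x"
    unfolding im_loc_eq by blast
  then show "brouwer_deg y \<Omega> z = 1"
    using reg[of x] avoid[of x] R by auto
qed

end

section \<open>Degree bounds from the covering\<close>

lemma regular_inner_covering_compact:
  assumes W: "regular_inner_covering \<Omega> W" and K: "compact K" "K \<subseteq> \<Omega>"
  obtains m where "K \<subseteq> W m"
proof -
  have mono: "W m \<subseteq> W n" if "m \<le> n" for m n
    using lift_Suc_mono_le[of W m n] W that by (simp add: regular_inner_covering_def)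
  have "\<And>m. open (W m)" "K \<subseteq> (\<Union>m\<in>UNIV. W m)"
    using W K(2) by (auto simp: regular_inner_covering_def)
  then obtain I where I: "finite I" "K \<subseteq> (\<Union>m\<in>I. W m)"
    by (rule compactE_image[OF K(1)])
  \<comment> \<open>The inserted 0 gives \<open>Max\<close> a value when \<open>I\<close> is empty,
    as may happen for empty \<open>K\<close>.\<close>
  have "W i \<subseteq> W (Max (insert 0 I))" if "i \<in> I" for i
    using I(1) that by (intro mono Max_ge) auto
  then show thesis using that I(2) by blast
qed

lemma regular_inner_covering_inner_open:
  assumes "regular_inner_covering \<Omega> W"
  shows "W m \<in> inner_open \<Omega>"
proof -
  have W: "open (W m)" "bounded (W m)" "W m \<subseteq> W (Suc m)" "closure (W (Suc m)) \<subseteq> \<Omega>"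
    using assms by (auto simp: regular_inner_covering_def compactly_contained_def)
  then show ?thesis
    using closure_mono[OF W(3)] by (auto simp: inner_open_iff compact_closure)
qed

text \<open>The value \<open>z\<close> may lie in the image of \<open>frontier (W m)\<close>, where
  \<open>DEG1_loc\<close> says nothing. Because that image has empty interior, some
  \<open>z'\<close> off it is so close to \<open>z\<close> that the degree on \<open>A\<close> is
  unchanged, and there the degree on \<open>W m\<close> dominates.\<close>

lemma (in strictly_orientation_preserving_map) deg_le_1_of_DEG1_loc:
  assumes W: "regular_inner_covering \<Omega> W" and deg: "DEG1_loc W y"
    and int: "\<And>m. interior (y ` frontier (W m)) = {}"
    and A: "A \<in> inner_open \<Omega>" and z: "z \<notin> y ` frontier A"
  shows "brouwer_deg y A z \<le> 1"
proof -
  note A' = inner_openD[OF A]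
  obtain m where m: "closure A \<subseteq> W m"
    using regular_inner_covering_compact[OF W A'(4,3)] .
  have Wm: "W m \<in> inner_open \<Omega>" by (rule regular_inner_covering_inner_open[OF W])
  obtain \<rho> where \<rho>: "\<rho> > 0" "\<And>z'. dist z' z < \<rho> \<Longrightarrow>
      z' \<notin> y ` frontier A \<and> brouwer_deg y A z' = brouwer_deg y A z"
    using deg_near[OF A z] by blast
  have "\<not> ball z \<rho> \<subseteq> y ` frontier (W m)"
  proof
    assume "ball z \<rho> \<subseteq> y ` frontier (W m)"
    then have "ball z \<rho> \<subseteq> interior (y ` frontier (W m))"
      by (rule interior_maximal) simp
    then show False using \<rho>(1) int by simp
  qed
  then obtain z' where z': "z' \<in> ball z \<rho>" "z' \<notin> y ` frontier (W m)" by blast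
  then have near: "z' \<notin> y ` frontier A" "brouwer_deg y A z' = brouwer_deg y A z"
    using \<rho>(2)[of z'] by (auto simp: dist_commute)
  have "brouwer_deg y A z' \<le> brouwer_deg y (W m) z'"
    using m closure_subset[of A] by (intro deg_mono[OF Wm A _ z'(2) near(1)]) blast
  also have "\<dots> \<le> 1" using deg z'(2) by (simp add: DEG1_loc_def)
  finally show ?thesis using near(2) by simp
qed

theorem corollary40:
  fixes \<Omega> :: "(real^'n) set"
    and y :: "real^'n \<Rightarrow> real^'n"
    and W :: "nat \<Rightarrow> (real^'n) set"
  assumes "CARD('n) \<ge> 2"
    and "open \<Omega>" and "bounded \<Omega>"
    and "continuous_on \<Omega> y"
    and "strictly_orientation_preserving \<Omega> y"
    and "regular_inner_covering \<Omega> W"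
    and "DEG1_loc W y"
    and "\<forall>m. interior (y ` frontier (W m)) = {}"
  shows "(\<forall>A\<in>inner_open \<Omega>. \<forall>z\<in>y ` A - y ` frontier A. brouwer_deg y A z = 1)
    \<and> (\<forall>z\<in>y ` reg_set \<Omega> y \<Omega>.
          connected (reg_set \<Omega> y \<Omega> \<inter> y -` {z}) \<and>
          reg_set \<Omega> y \<Omega> \<inter> y -` {z} \<subset>\<subset> reg_set \<Omega> y \<Omega>)
    \<and> (\<forall>z\<in>y ` \<Omega> - y ` reg_set \<Omega> y \<Omega>. \<forall>C\<in>components (\<Omega> \<inter> y -` {z}).
          closure C \<inter> frontier \<Omega> \<noteq> {})
    \<and> (im_loc \<Omega> y \<Omega> = y ` reg_set \<Omega> y \<Omega> \<and> interior (\<Omega> - reg_set \<Omega> y \<Omega>) = {})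
    \<and> (continuous_on (closure \<Omega>) y \<longrightarrow>
          im_loc \<Omega> y \<Omega> = y ` \<Omega> - y ` frontier \<Omega> \<and>
          (\<forall>z\<in>im_loc \<Omega> y \<Omega>. brouwer_deg y \<Omega> z = 1))"
proof -
  interpret strictly_orientation_preserving_map \<Omega> y
    by standard (rule assms)+
  interpret degree_one_map \<Omega> y
    by standard (rule deg_le_1_of_DEG1_loc[OF assms(6,7)], use assms(8) in auto)
  show ?thesis
    using deg_eq_1 reg_set_fibre closure_component_meets_frontier[OF \<open>bounded \<Omega>\<close>] im_loc_eq
      interior_irregular_set im_loc_continuous_closure[OF \<open>bounded \<Omega>\<close>]
    by (intro conjI ballI impI) auto
qed

end
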